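(* Let $q$ be a nonconstant, entire, $2\pi$-periodic function with $q(x)>0$ for all $x\in\mathbb R$. Put $$p(z)=C_1\exp(q(z)),\qquad C_1=\frac1{2\pi}\int_0^{2\pi}\exp(-q(x))\,dx,\qquad w(z)=\int_0^z\frac{1}{p(s)}\,ds ,$$ and for $n\in\mathbb Z$ let $y_n(z)=\exp(in\,w(z))$, which are the $2\pi$-periodic eigenfunctions (up to constant multiples) of the operator $p(z)\frac{d}{dz}$. If $T>0$ is sufficiently large, then there is an infinite dimensional subspace $\mathcal N\subset\mathbb H^2$ such that $$\langle y_n,g\rangle_H=0\qquad\text{for all }g\in\mathcal N\text{ and all }n\in\mathbb Z .$$
   Context: For $T>0$ let $\Omega=\{x+i\tau\in\mathbb C:\ -T<\tau<T\}$. $\mathbb H^2$ is the Hilbert space of $2\pi$-periodic functions $f(z)=\sum_{n\in\mathbb Z}c_ne^{inz}$ analytic in $\Omega$ with $\|f\|_H^2=\sum_n|c_n|^2\cosh(2nT)<\infty$, with inner product $\langle f,g\rangle_H=\frac1{4\pi}\int_0^{2\pi}[f(x+iT)\overline{g(x+iT)}+f(x-iT)\overline{g(x-iT)}]\,dx$ (boundary values taken in $L^2$ over a period). *)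

theory Defs
  imports "HOL-Complex_Analysis.Complex_Analysis" "HOL-Library.Function_Algebras"
begin

definition strip :: "real \<Rightarrow> complex set" where
  "strip T = {z. - T < Im z \<and> Im z < T}"

definition fscale :: "complex \<Rightarrow> (complex \<Rightarrow> complex) \<Rightarrow> complex \<Rightarrow> complex" where
  "fscale a f = (\<lambda>z. a * f z)"

global_interpretation cfun: vector_space fscale
  by unfold_locales (auto simp: fscale_def fun_eq_iff algebra_simps)

text \<open>Functions on the strip are represented by total functions vanishing outside it, so that
  equality of representatives is equality of functions on the strip and linear (in)dependence is
  not affected by values outside the strip.\<close>

definition H2 :: "real \<Rightarrow> (complex \<Rightarrow> complex) set" where
  "H2 T = {f. f holomorphic_on strip T
            \<and> (\<forall>z\<in>strip T. f (z + 2 * of_real pi) = f z)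
            \<and> (\<forall>z. z \<notin> strip T \<longrightarrow> f z = 0)
            \<and> (\<exists>c :: int \<Rightarrow> complex.
                 (\<forall>z\<in>strip T. ((\<lambda>n. c n * exp (\<i> * of_int n * z)) has_sum f z) UNIV)
                 \<and> (\<lambda>n. (cmod (c n))\<^sup>2 * cosh (2 * of_int n * T)) summable_on UNIV)}"

text \<open>\<open>b\<close> represents the boundary values of \<open>f\<close> on the line \<open>Im z = h\<close>, where \<open>h\<close> is \<open>T\<close> or \<open>-T\<close>:
  it is the limit in L2 over a period of \<open>x \<mapsto> f (x + \<i> \<tau>)\<close> as \<open>\<tau>\<close> tends to \<open>h\<close> from within
  \<open>(-T, T)\<close>. It depends only on the values of \<open>f\<close> in the strip and is unique
  almost everywhere on \<open>[0, 2\<pi>]\<close>, so the choice below does not affect integrals over a period.\<close>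

definition is_boundary_value ::
    "real \<Rightarrow> (complex \<Rightarrow> complex) \<Rightarrow> real \<Rightarrow> (real \<Rightarrow> complex) \<Rightarrow> bool" where
  "is_boundary_value T f h b \<longleftrightarrow>
     b \<in> borel_measurable borel
     \<and> set_integrable lborel {0..2 * pi} (\<lambda>x. (cmod (b x))\<^sup>2)
     \<and> ((\<lambda>\<tau>. LBINT x:{0..2 * pi}. (cmod (f (Complex x \<tau>) - b x))\<^sup>2) \<longlongrightarrow> 0)
         (at h within {- T<..<T})"

definition boundary_value :: "real \<Rightarrow> (complex \<Rightarrow> complex) \<Rightarrow> real \<Rightarrow> real \<Rightarrow> complex" where
  "boundary_value T f h = (SOME b. is_boundary_value T f h b)"

definition inner_H :: "real \<Rightarrow> (complex \<Rightarrow> complex) \<Rightarrow> (complex \<Rightarrow> complex) \<Rightarrow> complex" where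
  "inner_H T f g = 1 / (4 * of_real pi) *
     (LBINT x:{0..2 * pi}.
        boundary_value T f T x * cnj (boundary_value T g T x)
        + boundary_value T f (- T) x * cnj (boundary_value T g (- T) x))"

definition C1 :: "(complex \<Rightarrow> complex) \<Rightarrow> complex" where
  "C1 q = 1 / (2 * of_real pi) * (LBINT x:{0..2 * pi}. exp (- q (of_real x)))"

definition p_fun :: "(complex \<Rightarrow> complex) \<Rightarrow> complex \<Rightarrow> complex" where
  "p_fun q z = C1 q * exp (q z)"

definition w_fun :: "(complex \<Rightarrow> complex) \<Rightarrow> complex \<Rightarrow> complex" where
  "w_fun q z = contour_integral (linepath 0 z) (\<lambda>s. 1 / p_fun q s)"

definition y_fun :: "(complex \<Rightarrow> complex) \<Rightarrow> int \<Rightarrow> complex \<Rightarrow> complex" where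
  "y_fun q n z = exp (\<i> * of_int n * w_fun q z)"

definition periodic_eigenfunction ::
    "real \<Rightarrow> (complex \<Rightarrow> complex) \<Rightarrow> complex \<Rightarrow> (complex \<Rightarrow> complex) \<Rightarrow> bool" where
  "periodic_eigenfunction T p \<mu> f \<longleftrightarrow>
     f holomorphic_on strip T
     \<and> (\<forall>z\<in>strip T. f (z + 2 * of_real pi) = f z)
     \<and> (\<exists>z\<in>strip T. f z \<noteq> 0)
     \<and> (\<forall>z\<in>strip T. p z * deriv f z = \<mu> * f z)"

end

theory Submission
  imports Defs
begin

text \<open>
  Point evaluations are bounded functionals on \<open>H2 T\<close>, represented by reproducing kernels. If two points
  \<open>a\<close> and \<open>b\<close> of the strip satisfy \<open>w a = w b\<close>, then every \<open>y_fun q n\<close> takes the same value at both, and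
  so the difference of the kernels at \<open>a\<close> and \<open>b\<close> is orthogonal to all of them. The space \<open>N\<close> is the
  span of infinitely many such differences.

  Such points exist because \<open>w\<close> is not injective: an injective entire function is affine
  (\<open>injective_entire_derivative_constant\<close>), and then \<open>w' = 1/p\<close> and hence \<open>q\<close> would be constant. The
  open mapping theorem turns one coincidence \<open>w a = w b\<close> into infinitely many, at points that are
  pairwise incongruent modulo \<open>2\<pi>\<close> and have bounded imaginary parts (\<open>double_points_sequence\<close>); the
  bound serves as \<open>T0\<close>. The kernel differences are linearly independent since trigonometric
  polynomials separate incongruent points (\<open>kernel_differences_not_finitely_spanned\<close>).

  It suffices to test the reproducing property on entire \<open>2\<pi>\<close>-periodic functions \<open>Y\<close>
  (\<open>inner_H_kernel\<close>). As \<open>Y\<close> and the kernels are continuous up to the edges of the strip, the boundary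
  values in the inner product are ordinary restrictions (\<open>inner_H_extension\<close>). Integrating the kernel
  series term by term then leaves the Fourier series of \<open>Y\<close>, whose convergence (\<open>has_sum_fourier\<close>) is
  proved by a telescoping argument.

  The description of the eigenfunctions is the explicit solution of the linear equation \<open>p f' = \<mu> f\<close>
  (\<open>periodic_eigenfunction_iff\<close>).
\<close>

section \<open>Entire functions of period \<open>2\<pi>\<close>\<close>

definition entire_periodic :: "(complex \<Rightarrow> complex) \<Rightarrow> bool" where
  "entire_periodic f \<longleftrightarrow> f holomorphic_on UNIV \<and> (\<forall>z. f (z + 2 * of_real pi) = f z)"

lemma entire_periodic_holomorphic: "entire_periodic f \<Longrightarrow> f holomorphic_on UNIV"
  and entire_periodic_shift: "entire_periodic f \<Longrightarrow> f (z + 2 * of_real pi) = f z"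
  by (auto simp: entire_periodic_def)

lemma entire_periodic_has_derivative:
  "entire_periodic f \<Longrightarrow> (f has_field_derivative deriv f z) (at z)"
  using entire_periodic_holomorphic holomorphic_derivI by blast

lemma entire_periodic_continuous: "entire_periodic f \<Longrightarrow> continuous_on A f"
  using continuous_on_subset entire_periodic_holomorphic holomorphic_on_imp_continuous_on by blast

text \<open>Allowing an increment per period covers both periodic functions and the function \<open>w\<close>, which
  gains \<open>2\<pi>\<close>.\<close>

lemma quasiperiodic_int:
  fixes f :: "complex \<Rightarrow> complex"
  assumes "\<And>z. f (z + 2 * of_real pi) = f z + c"
  shows "f (z + of_int k * (2 * of_real pi)) = f z + of_int k * c"
proof (induction k rule: int_induct[of _ 0])
  case base
  then show ?case by simp
next
  case (step1 i)
  have "f (z + of_int (i + 1) * (2 * of_real pi)) = f ((z + of_int i * (2 * of_real pi)) + 2 * of_real pi)"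
    by (simp add: distrib_right add.assoc)
  also have "\<dots> = f z + of_int i * c + c" by (simp only: assms step1)
  finally show ?case by (simp add: distrib_right)
next
  case (step2 i)
  have "f z + of_int i * c = f (z + of_int i * (2 * of_real pi))" by (simp only: step2)
  also have "\<dots> = f ((z + of_int (i - 1) * (2 * of_real pi)) + 2 * of_real pi)"
    by (simp add: left_diff_distrib)
  also have "\<dots> = f (z + of_int (i - 1) * (2 * of_real pi)) + c" by (simp only: assms)
  finally show ?case by (simp add: left_diff_distrib) (metis add_diff_cancel_right' add_diff_eq)
qed

lemma entire_periodic_shift_int:
  "entire_periodic f \<Longrightarrow> f (z + of_int k * (2 * of_real pi)) = f z"
  using quasiperiodic_int[of f 0] by (simp add: entire_periodic_def)

lemma exp_i_eq_iff:
  "exp (\<i> * a) = exp (\<i> * b) \<longleftrightarrow> (\<exists>k::int. a = b + of_int k * (2 * of_real pi))"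
proof -
  have "\<i> * a = \<i> * b + (of_int (2 * k) * pi) * \<i> \<longleftrightarrow> a = b + of_int k * (2 * of_real pi)" for k::int
  proof -
    have "\<i> * b + (of_int (2 * k) * pi) * \<i> = \<i> * (b + of_int k * (2 * of_real pi))"
      by (simp add: algebra_simps)
    then show ?thesis by simp
  qed
  then show ?thesis unfolding exp_eq by simp
qed

lemma entire_periodic_eq_if_exp_eq:
  "entire_periodic f \<Longrightarrow> exp (\<i> * a) = exp (\<i> * b) \<Longrightarrow> f a = f b"
  by (auto simp: exp_i_eq_iff entire_periodic_shift_int)

lemma exp_2pi_periodic [simp]:
  "exp (\<i> * of_int n * (z + 2 * of_real pi)) = exp (\<i> * of_int n * z)"
proof -
  have "\<i> * of_int n * (z + 2 * of_real pi) = \<i> * of_int n * z + of_int n * (2 * of_real pi * \<i>)"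
    by (simp add: algebra_simps)
  then show ?thesis
    unfolding exp_eq by (intro exI[of _ n]) simp
qed

lemma entire_periodic_exp: "entire_periodic (\<lambda>z. exp (\<i> * of_int n * z))"
  unfolding entire_periodic_def
  by (intro conjI allI holomorphic_intros exp_2pi_periodic)

lemma entire_periodic_const: "entire_periodic (\<lambda>z. c)"
  by (auto simp: entire_periodic_def)

lemma entire_periodic_diff:
  "entire_periodic f \<Longrightarrow> entire_periodic g \<Longrightarrow> entire_periodic (\<lambda>z. f z - g z)"
  by (auto simp: entire_periodic_def intro!: holomorphic_intros)

lemma entire_periodic_mult:
  "entire_periodic f \<Longrightarrow> entire_periodic g \<Longrightarrow> entire_periodic (\<lambda>z. f z * g z)"
  by (auto simp: entire_periodic_def intro!: holomorphic_intros)

lemma entire_periodic_prod: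
  "(\<And>i. i \<in> I \<Longrightarrow> entire_periodic (f i)) \<Longrightarrow> entire_periodic (\<lambda>z. \<Prod>i\<in>I. f i z)"
  by (induction I rule: infinite_finite_induct)
     (auto intro!: entire_periodic_const entire_periodic_mult)

lemma translate_has_derivative:
  fixes f :: "complex \<Rightarrow> complex"
  assumes "\<And>z. (f has_field_derivative f' z) (at z)"
  shows "((\<lambda>z. f (z + a)) has_field_derivative f' (z + a)) (at z)"
  using assms[of "z + a"] by (simp add: DERIV_shift)

lemma entire_constant_if_derivative_zero:
  fixes f :: "complex \<Rightarrow> complex"
  assumes "\<And>z. (f has_field_derivative 0) (at z)"
  shows "f z = f u"
  using has_field_derivative_zero_constant[of UNIV f] assms by auto

text \<open>The increment of a primitive over one period has derivative zero, so it may be computed at any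
  base point \<open>u\<close>. This gives both the quasi-periodicity of \<open>w\<close> and the independence of contour
  integrals of the height of the line.\<close>

lemma quasiperiodic_primitive:
  fixes F f :: "complex \<Rightarrow> complex"
  assumes "\<And>z. (F has_field_derivative f z) (at z)" and "\<And>z. f (z + a) = f z"
  shows "F (z + a) = F z + (F (u + a) - F u)"
proof -
  have "((\<lambda>z. F (z + a) - F z) has_field_derivative 0) (at z)" for z
    using DERIV_diff[OF translate_has_derivative[OF assms(1), of a] assms(1), of z] assms(2) by simp
  from entire_constant_if_derivative_zero[OF this, of z u] show ?thesis
    by (simp add: algebra_simps)
qed

lemma entire_primitive:
  assumes "f holomorphic_on UNIV"
  obtains F where "\<And>z::complex. (F has_field_derivative f z) (at z)"
  using holomorphic_convex_primitive'[OF convex_UNIV open_UNIV assms] by auto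

section \<open>Fourier expansion\<close>

text \<open>With a primitive \<open>F\<close> of \<open>f\<close>, the integral is the increment of \<open>F\<close> over one period, which does not
  depend on where the period starts. This replaces Cauchy's theorem on a rectangle.\<close>

lemma entire_periodic_integral_horizontal:
  assumes f: "entire_periodic f"
  shows "integral {0..2 * pi} (\<lambda>x. f (Complex x \<tau>)) = integral {0..2 * pi} (\<lambda>x. f (of_real x))"
proof -
  obtain F where F: "\<And>z. (F has_field_derivative f z) (at z)"
    using entire_primitive[OF entire_periodic_holomorphic[OF f]] by blast
  have *: "integral {0..2 * pi} (\<lambda>x. f (Complex x \<tau>)) = F (2 * of_real pi) - F 0" for \<tau>
  proof -
    have "((\<lambda>x. F (Complex x \<tau>)) has_vector_derivative f (Complex x \<tau>)) (at x within S)" for x S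
    proof -
      have "((\<lambda>x. of_real x + \<i> * of_real \<tau>) has_vector_derivative 1) (at x)"
        using has_vector_derivative_add[OF has_vector_derivative_of_real[OF DERIV_ident] has_vector_derivative_const] by simp
      from field_vector_diff_chain_at[OF this F]
      have "((\<lambda>x. F (Complex x \<tau>)) has_vector_derivative f (Complex x \<tau>)) (at x)"
        by (simp add: Complex_eq o_def)
      then show ?thesis by (rule has_vector_derivative_at_within)
    qed
    then have "((\<lambda>x. f (Complex x \<tau>)) has_integral F (Complex (2 * pi) \<tau>) - F (Complex 0 \<tau>)) {0..2 * pi}"
      by (intro fundamental_theorem_of_calculus) auto
    moreover have "F (Complex (2 * pi) \<tau>) = F (Complex 0 \<tau>) + (F (2 * of_real pi) - F 0)"
    proof -
      have "Complex (2 * pi) \<tau> = Complex 0 \<tau> + 2 * of_real pi"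
        by (simp add: complex_eq_iff)
      then show ?thesis
        using quasiperiodic_primitive[OF F entire_periodic_shift[OF f], of "Complex 0 \<tau>" 0] by simp
    qed
    ultimately show ?thesis by (simp add: integral_unique)
  qed
  have "(\<lambda>x. f (of_real x)) = (\<lambda>x. f (Complex x 0))"
    by (simp add: complex_of_real_def)
  then show ?thesis using *[of 0] *[of \<tau>] by simp
qed

definition fourier_coeff :: "(complex \<Rightarrow> complex) \<Rightarrow> int \<Rightarrow> complex" where
  "fourier_coeff f n = 1 / (2 * of_real pi) *
     integral {0..2 * pi} (\<lambda>x. f (of_real x) * exp (- \<i> * of_int n * of_real x))"

lemma entire_periodic_mult_exp:
  "entire_periodic f \<Longrightarrow> entire_periodic (\<lambda>z. f z * exp (- \<i> * of_int n * z))"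
  using entire_periodic_mult[OF _ entire_periodic_exp[of "- n"]] by simp

lemma fourier_coeff_horizontal:
  assumes "entire_periodic f"
  shows "fourier_coeff f n = 1 / (2 * of_real pi) *
     integral {0..2 * pi} (\<lambda>x. f (Complex x \<tau>) * exp (- \<i> * of_int n * Complex x \<tau>))"
  unfolding fourier_coeff_def
  using entire_periodic_integral_horizontal[OF entire_periodic_mult_exp[OF assms, of n], of \<tau>] by simp

lemma norm_exp_int: "cmod (exp (\<i> * of_int n * z)) = exp (- of_int n * Im z)"
  by (simp add: norm_exp_eq_Re)

text \<open>On the line at height \<open>\<tau>\<close> the exponential has modulus \<open>exp (n \<tau>)\<close>, so integrating along the
  lines at heights \<open>r\<close> and \<open>-r\<close> gives decay at any prescribed exponential rate \<open>r\<close>.\<close>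

lemma fourier_coeff_bound:
  assumes f: "entire_periodic f"
  obtains M where "M \<ge> 0" "\<And>n. cmod (fourier_coeff f n) \<le> M * exp (- r * \<bar>of_int n\<bar>)"
proof -
  have ex: "\<exists>M\<ge>0. \<forall>x\<in>{0..2 * pi}. cmod (f (Complex x \<tau>)) \<le> M" for \<tau>
  proof -
    have "continuous_on {0..2 * pi} (\<lambda>x. f (Complex x \<tau>))"
    proof (rule continuous_on_compose2[OF entire_periodic_continuous[OF f, of UNIV]])
      show "continuous_on {0..2 * pi} (\<lambda>x. Complex x \<tau>)"
        by (simp add: Complex_eq) (intro continuous_intros)
    qed auto
    then have "bounded ((\<lambda>x. f (Complex x \<tau>)) ` {0..2 * pi})"
      by (intro compact_imp_bounded compact_continuous_image) auto
    then show ?thesis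
      by (auto simp: bounded_pos dest: less_imp_le)
  qed
  obtain M1 where M1: "M1 \<ge> 0" "\<And>x. x \<in> {0..2 * pi} \<Longrightarrow> cmod (f (Complex x r)) \<le> M1"
    using ex[of r] by blast
  obtain M2 where M2: "M2 \<ge> 0" "\<And>x. x \<in> {0..2 * pi} \<Longrightarrow> cmod (f (Complex x (- r))) \<le> M2"
    using ex[of "- r"] by blast
  have key: "cmod (fourier_coeff f n) \<le> M * exp (of_int n * \<tau>)"
    if M: "\<And>x. x \<in> {0..2 * pi} \<Longrightarrow> cmod (f (Complex x \<tau>)) \<le> M" for n M \<tau>
  proof -
    let ?h = "\<lambda>x. f (Complex x \<tau>) * exp (- \<i> * of_int n * Complex x \<tau>)"
    have cont: "continuous_on {0..2 * pi} ?h"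
    proof (rule continuous_on_compose2[OF entire_periodic_continuous[OF entire_periodic_mult_exp[OF f], of UNIV]])
      show "continuous_on {0..2 * pi} (\<lambda>x. Complex x \<tau>)"
        by (simp add: Complex_eq) (intro continuous_intros)
    qed auto
    have "cmod (integral {0..2 * pi} ?h) \<le> (M * exp (of_int n * \<tau>)) * (2 * pi - 0)"
    proof (rule integral_bound[OF _ cont])
      fix x assume x: "x \<in> {0..2 * pi}"
      have "cmod (exp (- \<i> * of_int n * Complex x \<tau>)) = exp (of_int n * \<tau>)"
        using norm_exp_int[of "- n" "Complex x \<tau>"] by simp
      then show "cmod (?h x) \<le> M * exp (of_int n * \<tau>)"
        using M[OF x] by (simp add: norm_mult mult_right_mono)
    qed simp
    then show ?thesis
      unfolding fourier_coeff_horizontal[OF f, of n \<tau>]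
      by (simp add: norm_mult norm_divide field_simps)
  qed
  show ?thesis
  proof (rule that[of "max M1 M2"])
    fix n :: int
    show "cmod (fourier_coeff f n) \<le> max M1 M2 * exp (- r * \<bar>of_int n\<bar>)"
    proof (cases "n \<ge> 0")
      case True
      have "cmod (fourier_coeff f n) \<le> max M1 M2 * exp (of_int n * (- r))"
        by (rule key[OF order_trans[OF M2(2)]]) auto
      with True show ?thesis by (simp add: mult.commute)
    next
      case False
      have "cmod (fourier_coeff f n) \<le> max M1 M2 * exp (of_int n * r)"
        by (rule key[OF order_trans[OF M1(2)]]) auto
      with False show ?thesis by (simp add: mult.commute)
    qed
  qed (use M1 in auto)
qed

lemma summable_on_exp_abs_int:
  fixes r :: real
  assumes "r > 0"
  shows "(\<lambda>n::int. exp (- r * \<bar>of_int n\<bar>)) summable_on UNIV"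
proof -
  have nat: "(\<lambda>n::nat. exp (- r * of_nat n)) summable_on UNIV"
  proof -
    have "summable (\<lambda>n::nat. exp (- r) ^ n)"
      using assms summable_geometric[of "exp (- r)"] by simp
    then have "summable (\<lambda>n::nat. norm (exp (- r * of_nat n)))"
      by (simp add: exp_of_nat_mult[symmetric] mult.commute)
    then show ?thesis by (rule norm_summable_imp_summable_on)
  qed
  have img: "(\<lambda>n::int. exp (- r * \<bar>of_int n\<bar>)) summable_on range (\<lambda>n. s * int n)"
    if "s = 1 \<or> s = - 1" for s
  proof -
    have "inj (\<lambda>n. s * int n)" using that by (auto simp: inj_def)
    moreover have "(\<lambda>n::int. exp (- r * \<bar>of_int n\<bar>)) \<circ> (\<lambda>n. s * int n) = (\<lambda>n::nat. exp (- r * of_nat n))"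
      using that by auto
    ultimately show ?thesis using nat by (simp add: summable_on_reindex)
  qed
  have "UNIV = range (\<lambda>n. 1 * int n) \<union> range (\<lambda>n. (- 1) * int n)"
  proof -
    have "k \<in> range (\<lambda>n. 1 * int n) \<union> range (\<lambda>n. (- 1) * int n)" for k
      by (cases k rule: int_cases2) auto
    then show ?thesis by blast
  qed
  then show ?thesis
    using summable_on_union[OF img[of 1] img[of "-1"]] by simp
qed

lemma fourier_series_abs_summable:
  assumes f: "entire_periodic f"
  shows "(\<lambda>n. norm (fourier_coeff f n * exp (\<i> * of_int n * z))) summable_on UNIV"
proof -
  obtain M where M: "M \<ge> 0" "\<And>n. cmod (fourier_coeff f n) \<le> M * exp (- (\<bar>Im z\<bar> + 1) * \<bar>of_int n\<bar>)"
    using fourier_coeff_bound[OF f] by metis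
  show ?thesis
  proof (rule Infinite_Sum.abs_summable_on_comparison_test')
    show "(\<lambda>n::int. M * exp (- 1 * \<bar>of_int n\<bar>)) summable_on UNIV"
      by (intro summable_on_cmult_right summable_on_exp_abs_int) simp
    fix n :: int
    have "cmod (exp (\<i> * of_int n * z)) \<le> exp (\<bar>Im z\<bar> * \<bar>of_int n\<bar>)"
      unfolding norm_exp_int exp_le_cancel_iff
      using abs_ge_self[of "- of_int n * Im z"] by (simp add: abs_mult mult.commute)
    then have "cmod (fourier_coeff f n * exp (\<i> * of_int n * z))
        \<le> (M * exp (- (\<bar>Im z\<bar> + 1) * \<bar>of_int n\<bar>)) * exp (\<bar>Im z\<bar> * \<bar>of_int n\<bar>)"
      unfolding norm_mult using M by (intro mult_mono) auto
    also have "\<dots> = M * exp (- 1 * \<bar>of_int n\<bar>)"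
      by (simp add: exp_add[symmetric] algebra_simps)
    finally show "cmod (fourier_coeff f n * exp (\<i> * of_int n * z)) \<le> M * exp (- 1 * \<bar>of_int n\<bar>)" .
  qed
qed

text \<open>The zeros of \<open>1 - exp (\<i> * (z - s))\<close> in \<open>s\<close> are the translates of \<open>z\<close> by multiples of \<open>2\<pi>\<close>; they
  are simple and \<open>f\<close> vanishes there by periodicity, so the singularities of the quotient are removable.\<close>

lemma entire_periodic_factor:
  assumes f: "entire_periodic f" and z: "f z = 0"
  obtains Q where "entire_periodic Q" "\<And>s. f s = (1 - exp (\<i> * (z - s))) * Q s"
proof -
  define e where "e = (\<lambda>s. 1 - exp (\<i> * (z - s)))"
  define Q where "Q = (\<lambda>s. if e s = 0 then deriv f z / \<i> else f s / e s)"
  have e_eq_0: "e s = 0 \<longleftrightarrow> exp (\<i> * z) = exp (\<i> * s)" for s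
  proof -
    have "e s = 0 \<longleftrightarrow> 1 = exp (\<i> * z) / exp (\<i> * s)"
      by (simp only: e_def right_minus_eq right_diff_distrib exp_diff)
    then show ?thesis by (auto simp: eq_divide_eq)
  qed
  have e_hol: "e holomorphic_on A" for A
    unfolding e_def by (intro holomorphic_intros)
  have f_hol: "f holomorphic_on A" for A
    using entire_periodic_holomorphic[OF f] holomorphic_on_subset by blast
  have f0: "f s = 0" if "e s = 0" for s
    using entire_periodic_eq_if_exp_eq[OF f] that z by (metis e_eq_0)
  have e_per: "e (s + 2 * of_real pi) = e s" for s
  proof -
    have "exp (\<i> * (z - s)) = exp (\<i> * (z - (s + 2 * of_real pi)))"
      unfolding exp_i_eq_iff by (rule exI[of _ 1]) simp
    then show ?thesis by (simp add: e_def)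
  qed
  have near: "Q holomorphic_on ball u 1" if u: "e u = 0" for u
  proof -
    \<comment> \<open>Near a zero \<open>u\<close> of \<open>e\<close>, dividing numerator and denominator by \<open>s - u\<close> makes the denominator nonzero.\<close>
    define g1 where "g1 = (\<lambda>s. if s = u then deriv f u else (f s - f u) / (s - u))"
    define g2 where "g2 = (\<lambda>s. if s = u then deriv e u else (e s - e u) / (s - u))"
    have g1: "g1 holomorphic_on ball u 1" unfolding g1_def by (rule pole_lemma_open[OF f_hol open_ball])
    have g2: "g2 holomorphic_on ball u 1" unfolding g2_def by (rule pole_lemma_open[OF e_hol open_ball])
    have du: "deriv e u = \<i>"
    proof -
      have "(e has_field_derivative \<i> * exp (\<i> * (z - u))) (at u)"
        unfolding e_def by (auto intro!: derivative_eq_intros)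
      then show ?thesis using u by (simp add: DERIV_imp_deriv e_def)
    qed
    have uniq: "s = u" if "e s = 0" "s \<in> ball u 1" for s
    proof -
      have "exp (\<i> * s) = exp (\<i> * u)" using that(1) u by (metis e_eq_0)
      then obtain k :: int where k: "s = u + of_int k * (2 * of_real pi)"
        by (auto simp: exp_i_eq_iff)
      with that(2) have "\<bar>of_int k\<bar> * (2 * pi) < 1"
        by (simp add: dist_norm norm_mult)
      moreover have "1 * (2 * pi) \<le> \<bar>of_int k\<bar> * (2 * pi)" if "k \<noteq> 0"
        using that by (intro mult_right_mono) auto
      ultimately have "k = 0"
        using pi_gt3 by linarith
      then show ?thesis using k by simp
    qed
    have "deriv f u = deriv f z"
    proof -
      have "exp (\<i> * u) = exp (\<i> * z)" using u by (simp add: e_eq_0)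
      then obtain k :: int where k: "u = z + of_int k * (2 * of_real pi)"
        by (auto simp: exp_i_eq_iff)
      let ?a = "of_int k * (2 * of_real pi) :: complex"
      have "((\<lambda>s. f (s + ?a)) has_field_derivative deriv f (z + ?a)) (at z)"
        by (rule translate_has_derivative[OF entire_periodic_has_derivative[OF f]])
      then have "(f has_field_derivative deriv f (z + ?a)) (at z)"
        by (simp only: entire_periodic_shift_int[OF f])
      then show ?thesis unfolding k by (rule DERIV_imp_deriv[symmetric])
    qed
    then have quot: "g1 s / g2 s = Q s" if "s \<in> ball u 1" for s
    proof (cases "s = u")
      case True
      then show ?thesis using u du \<open>deriv f u = deriv f z\<close> by (simp add: Q_def g1_def g2_def)
    next
      case False
      then have "e s \<noteq> 0" using uniq[OF _ that] by blast
      then show ?thesis using False u f0[OF u] by (simp add: Q_def g1_def g2_def)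
    qed
    have nz: "g2 s \<noteq> 0" if "s \<in> ball u 1" for s
    proof (cases "s = u")
      case True
      then show ?thesis using du by (simp add: g2_def)
    next
      case False
      then have "e s \<noteq> 0" using uniq[OF _ that] by blast
      then show ?thesis using False u by (simp add: g2_def)
    qed
    show ?thesis
      by (rule holomorphic_transform[OF holomorphic_on_divide[OF g1 g2 nz] quot])
  qed
  have "Q field_differentiable at s" for s
  proof (cases "e s = 0")
    case True
    then show ?thesis
      by (intro holomorphic_on_imp_differentiable_at[OF near open_ball]) auto
  next
    case False
    have "open {s. e s \<noteq> 0}"
      using holomorphic_on_imp_continuous_on[OF e_hol[of UNIV]]
      by (intro open_Collect_neq) auto
    moreover have "Q holomorphic_on {s. e s \<noteq> 0}"
      by (rule holomorphic_transform[where f = "\<lambda>s. f s / e s"])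
         (auto intro!: holomorphic_on_divide e_hol f_hol simp: Q_def)
    ultimately show ?thesis
      using False holomorphic_on_imp_differentiable_at by blast
  qed
  then have "Q holomorphic_on UNIV"
    by (simp add: holomorphic_on_def)
  then have "entire_periodic Q"
    unfolding entire_periodic_def Q_def e_per entire_periodic_shift[OF f] by blast
  moreover have "f s = e s * Q s" for s
    using f0 by (simp add: Q_def)
  ultimately show ?thesis using that by (simp add: e_def)
qed

lemma fourier_coeff_integrable:
  assumes "entire_periodic f"
  shows "(\<lambda>x. f (of_real x) * exp (- \<i> * of_int n * of_real x)) integrable_on {0..2 * pi}"
  by (intro integrable_continuous_real continuous_intros
        continuous_on_compose2[OF entire_periodic_continuous[OF assms, of UNIV]]) auto

text \<open>Raising the line of integration by 1 multiplies the integrand by \<open>exp n\<close> but leaves the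
  coefficient unchanged.\<close>

lemma fourier_coeff_const: "fourier_coeff (\<lambda>_. c) n = (if n = 0 then c else 0)"
proof (cases "n = 0")
  case True
  then show ?thesis by (simp add: fourier_coeff_def scaleR_conv_of_real)
next
  case False
  have "c * exp (- \<i> * of_int n * Complex x 1)
      = exp (of_int n) * (c * exp (- \<i> * of_int n * of_real x))" for x
  proof -
    have "exp (- \<i> * of_int n * Complex x 1) = exp (of_int n) * exp (- \<i> * of_int n * of_real x)"
      unfolding mult_exp_exp
      by (rule arg_cong[of _ _ exp]) (simp add: Complex_eq algebra_simps)
    then show ?thesis by simp
  qed
  then have eq: "(\<lambda>x. c * exp (- \<i> * of_int n * Complex x 1))
      = (\<lambda>x. exp (of_int n) * (c * exp (- \<i> * of_int n * of_real x)))"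
    by (rule ext)
  have "fourier_coeff (\<lambda>_. c) n = 1 / (2 * of_real pi) *
      integral {0..2 * pi} (\<lambda>x. c * exp (- \<i> * of_int n * Complex x 1))"
    by (rule fourier_coeff_horizontal[OF entire_periodic_const])
  also have "\<dots> = exp (of_int n) * fourier_coeff (\<lambda>_. c) n"
    unfolding eq fourier_coeff_def by simp
  finally have "fourier_coeff (\<lambda>_. c) n = exp (of_int n) * fourier_coeff (\<lambda>_. c) n" .
  moreover have "exp (of_int n :: complex) \<noteq> 1"
    using False by (simp add: exp_eq_1)
  ultimately show ?thesis using False by simp
qed

text \<open>After subtracting the constant \<open>f z\<close> one may write \<open>f s - f z = (1 - exp (\<i> * (z - s))) * Q s\<close> with
  \<open>Q\<close> entire and periodic. In terms of the absolutely summable \<open>t n\<close>, the terms of the series of \<open>Q\<close>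
  at \<open>z\<close>, the \<open>n\<close>-th term for \<open>f - f z\<close> is \<open>t n - t (n + 1)\<close>, so that series telescopes to 0.\<close>

lemma has_sum_fourier:
  assumes f: "entire_periodic f"
  shows "((\<lambda>n. fourier_coeff f n * exp (\<i> * of_int n * z)) has_sum f z) UNIV"
proof -
  define g where "g = (\<lambda>s. f s - f z)"
  have g: "entire_periodic g"
    unfolding g_def by (intro entire_periodic_diff entire_periodic_const f)
  obtain Q where Q: "entire_periodic Q" "\<And>s. g s = (1 - exp (\<i> * (z - s))) * Q s"
    using entire_periodic_factor[OF g, of z] by (auto simp: g_def)
  define t where "t = (\<lambda>n. fourier_coeff Q n * exp (\<i> * of_int n * z))"
  have gQ: "fourier_coeff g n * exp (\<i> * of_int n * z) = t n - t (n + 1)" for n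
  proof -
    have "g (of_real x) * exp (- \<i> * of_int n * of_real x)
        = Q (of_real x) * exp (- \<i> * of_int n * of_real x)
          - exp (\<i> * z) * (Q (of_real x) * exp (- \<i> * of_int (n + 1) * of_real x))" for x
    proof -
      have "exp (\<i> * (z - of_real x)) * exp (- \<i> * of_int n * of_real x)
          = exp (\<i> * z) * exp (- \<i> * of_int (n + 1) * of_real x)"
        unfolding mult_exp_exp by (rule arg_cong[of _ _ exp]) (simp add: algebra_simps)
      then show ?thesis
        unfolding Q(2) by (simp only: left_diff_distrib mult.assoc mult.left_commute mult_1)
    qed
    then have coeff: "fourier_coeff g n = fourier_coeff Q n - exp (\<i> * z) * fourier_coeff Q (n + 1)"
      unfolding fourier_coeff_def
      using fourier_coeff_integrable[OF Q(1), of n] fourier_coeff_integrable[OF Q(1), of "n + 1"]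
      by (simp add: Henstock_Kurzweil_Integration.integral_diff integrable_on_mult_right right_diff_distrib)
    have "exp (\<i> * of_int (n + 1) * z) = exp (\<i> * z) * exp (\<i> * of_int n * z)"
      unfolding mult_exp_exp by (rule arg_cong[of _ _ exp]) (simp add: algebra_simps)
    then show ?thesis
      unfolding t_def coeff by (simp only: left_diff_distrib mult.assoc mult.left_commute)
  qed
  have fg: "fourier_coeff f n = fourier_coeff g n + (if n = 0 then f z else 0)" for n
  proof -
    have "f (of_real x) * exp (- \<i> * of_int n * of_real x)
        = g (of_real x) * exp (- \<i> * of_int n * of_real x) + f z * exp (- \<i> * of_int n * of_real x)" for x
      by (simp add: g_def algebra_simps)
    then have "fourier_coeff f n = fourier_coeff g n + fourier_coeff (\<lambda>_. f z) n"
      unfolding fourier_coeff_def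
      using fourier_coeff_integrable[OF g, of n]
        fourier_coeff_integrable[OF entire_periodic_const, of "f z" n]
      by (simp add: Henstock_Kurzweil_Integration.integral_add distrib_left)
    then show ?thesis by (simp add: fourier_coeff_const)
  qed
  have "t summable_on UNIV"
    unfolding t_def by (rule abs_summable_summable[OF fourier_series_abs_summable[OF Q(1)]])
  then obtain S where S: "(t has_sum S) UNIV" by (auto simp: summable_on_def)
  have "bij (\<lambda>n::int. n + 1)"
    by (rule bij_betw_byWitness[of _ "\<lambda>n. n - 1"]) auto
  then have S': "((\<lambda>n. t (n + 1)) has_sum S) UNIV"
    using has_sum_reindex_bij_betw[of "\<lambda>n::int. n + 1" UNIV UNIV t S] S by (simp only:)
  have "((\<lambda>n. t n - t (n + 1)) has_sum (S - S)) UNIV"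
    using has_sum_add[OF S has_sum_uminus[THEN iffD2], of "\<lambda>n. t (n + 1)" "- S"] S' by simp
  moreover have "((\<lambda>n::int. if n = 0 then f z else 0) has_sum f z) UNIV"
    using has_sum_finite_neutralI[of "{0}" UNIV "\<lambda>n::int. if n = 0 then f z else 0" "f z"] by simp
  ultimately have "((\<lambda>n. (t n - t (n + 1)) + (if n = 0 then f z else 0)) has_sum (S - S + f z)) UNIV"
    by (rule has_sum_add)
  moreover have "(t n - t (n + 1)) + (if n = 0 then f z else 0) = fourier_coeff f n * exp (\<i> * of_int n * z)" for n
    unfolding gQ[symmetric] fg by (cases "n = 0") (simp_all add: distrib_right)
  ultimately show ?thesis by (simp only: diff_self add_0)
qed

section \<open>Injectivity and multiple values of entire functions\<close>

text \<open>By the open mapping theorem an injective \<open>f\<close> stays at a positive distance from \<open>f 0\<close> outside the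
  unit disc. Hence the reciprocal of the divided difference \<open>(f z - f 0) / z\<close>, which is entire because
  the divided difference has no zero, grows at most linearly and is therefore affine by Liouville's
  theorem; having no zero itself, it is constant, and so \<open>f\<close> is affine.\<close>

lemma injective_entire_derivative_constant:
  fixes f :: "complex \<Rightarrow> complex"
  assumes hol: "f holomorphic_on UNIV" and inj: "inj f" and nz: "deriv f 0 \<noteq> 0"
  obtains c where "\<And>z. deriv f z = c"
proof -
  define g where "g = (\<lambda>z. if z = 0 then deriv f 0 else (f z - f 0) / (z - 0))"
  have g: "g holomorphic_on UNIV"
    unfolding g_def by (rule pole_lemma_open[OF hol open_UNIV])
  have g0: "g z \<noteq> 0" for z
    using nz by (auto simp: g_def inj_eq[OF inj])
  have gi: "(\<lambda>z. inverse (g z)) holomorphic_on UNIV"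
    using g g0 by (intro holomorphic_intros) auto
  have "open (f ` ball 0 1)"
  proof (rule open_mapping_thm[OF hol open_UNIV connected_UNIV])
    show "\<not> f constant_on UNIV"
    proof
      assume "f constant_on UNIV"
      then have "f 0 = f 1" by (auto simp: constant_on_def)
      then show False by (simp add: inj_eq[OF inj])
    qed
  qed auto
  then obtain e where e: "e > 0" "ball (f 0) e \<subseteq> f ` ball 0 1"
    by (meson centre_in_ball imageI openE zero_less_one)
  have far: "e \<le> norm (f z - f 0)" if "1 \<le> norm z" for z
  proof (rule ccontr)
    assume "\<not> e \<le> norm (f z - f 0)"
    then have "f z \<in> f ` ball 0 1"
      using e(2) by (auto simp: dist_norm norm_minus_commute)
    then show False using that by (auto simp: inj_eq[OF inj])
  qed
  have bound: "norm (inverse (g z)) \<le> (1 / e) * norm z ^ 1" if "1 \<le> norm z" for z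
  proof -
    have "norm (inverse (g z)) = norm z / norm (f z - f 0)"
      using that by (auto simp: g_def norm_divide)
    also have "\<dots> \<le> norm z / e"
      using far[OF that] e(1) by (intro divide_left_mono mult_pos_pos) auto
    finally show ?thesis by simp
  qed
  define a b where "a = inverse (g 0)" and "b = deriv (\<lambda>z. inverse (g z)) 0"
  have lin: "inverse (g z) = a + b * z" for z
    using Liouville_polynomial[OF gi bound, where \<xi> = z] by (simp add: a_def b_def)
  have "b = 0"
  proof (rule ccontr)
    assume "b \<noteq> 0"
    then have "inverse (g (- a / b)) = 0" by (simp add: lin)
    then show False using g0 by simp
  qed
  have ga: "g z = inverse a" for z
    using lin[of z] \<open>b = 0\<close> by (metis add_0_right inverse_inverse_eq mult_zero_left)
  have "f z = f 0 + inverse a * z" for z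
  proof (cases "z = 0")
    case False
    then have "(f z - f 0) / z = inverse a"
      using ga[of z] by (simp only: g_def if_False diff_0_right)
    then have "f z - f 0 = inverse a * z"
      using False by (simp only: nonzero_divide_eq_eq not_False_eq_True)
    then show ?thesis by (simp only: diff_eq_eq add.commute)
  qed simp
  then have *: "f = (\<lambda>z. f 0 + inverse a * z)" by (rule ext)
  have "((\<lambda>z. f 0 + inverse a * z) has_field_derivative inverse a) (at z)" for z
    by (auto intro!: derivative_eq_intros)
  then have "(f has_field_derivative inverse a) (at z)" for z
    unfolding *[symmetric] .
  then show ?thesis using that DERIV_imp_deriv by blast
qed

text \<open>One pair of distinct points with the same value yields infinitely many: around both points the open
  mapping theorem provides preimages of all values near the common one. Points whose values differ by
  less than 2 cannot be congruent modulo \<open>2\<pi>\<close> without being equal, because translating by \<open>2\<pi> n\<close> adds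
  \<open>2\<pi> n\<close> to the value; so all points obtained are pairwise incongruent.\<close>

lemma double_points_sequence:
  fixes f :: "complex \<Rightarrow> complex"
  assumes hol: "f holomorphic_on UNIV"
    and shift: "\<And>z. f (z + 2 * of_real pi) = f z + 2 * of_real pi"
    and ninj: "\<not> inj f"
  obtains a b :: "nat \<Rightarrow> complex" and R :: real
  where "\<forall>k. f (a k) = f (b k)" "\<forall>k. \<bar>Im (a k)\<bar> < R \<and> \<bar>Im (b k)\<bar> < R"
    "inj (\<lambda>k. exp (\<i> * a k))" "\<forall>j k. exp (\<i> * a j) \<noteq> exp (\<i> * b k)"
proof -
  obtain a0 b0 where ab: "f a0 = f b0" "a0 \<noteq> b0" using ninj by (auto simp: inj_def)
  define r where "r = dist a0 b0 / 2"
  have r: "r > 0" using ab by (simp add: r_def)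
  have disj: "ball a0 r \<inter> ball b0 r = {}"
    unfolding r_def by (intro disjoint_ballI) simp
  have nonconst: "\<not> f constant_on UNIV"
  proof
    assume "f constant_on UNIV"
    then have "f (0 + 2 * of_real pi) = f 0" unfolding constant_on_def by auto
    then show False unfolding shift by simp
  qed
  have open_image: "open (f ` ball c r)" for c
    by (rule open_mapping_thm[OF hol open_UNIV connected_UNIV open_ball _ nonconst]) simp
  define V where "V = f ` ball a0 r \<inter> f ` ball b0 r \<inter> ball (f a0) 1"
  have "open V" unfolding V_def by (intro open_Int open_image open_ball)
  moreover have "f a0 \<in> V"
    using imageI[of a0 "ball a0 r" f] imageI[of b0 "ball b0 r" f] r ab(1) by (simp add: V_def)
  ultimately have "infinite V"
    using finite_imp_not_open by blast
  then obtain v :: "nat \<Rightarrow> complex" where v: "inj v" "range v \<subseteq> V"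
    using infinite_countable_subset by blast
  have vV: "v k \<in> f ` ball a0 r" "v k \<in> f ` ball b0 r" "v k \<in> ball (f a0) 1" for k
    using v(2) rangeI[of v k] unfolding V_def by blast+
  define a where "a = (\<lambda>k. inv_into (ball a0 r) f (v k))"
  define b where "b = (\<lambda>k. inv_into (ball b0 r) f (v k))"
  have a: "a k \<in> ball a0 r" "f (a k) = v k" for k
    unfolding a_def by (rule inv_into_into[OF vV(1)], rule f_inv_into_f[OF vV(1)])
  have b: "b k \<in> ball b0 r" "f (b k) = v k" for k
    unfolding b_def by (rule inv_into_into[OF vV(2)], rule f_inv_into_f[OF vV(2)])
  have close: "x = y" if e: "exp (\<i> * x) = exp (\<i> * y)" and fx: "f x = v j" and fy: "f y = v k" for x y j k
  proof -
    obtain n :: int where n: "x = y + of_int n * (2 * of_real pi)"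
      using e by (auto simp: exp_i_eq_iff)
    have "f x = f y + of_int n * (2 * of_real pi)"
      unfolding n by (rule quasiperiodic_int[of f, OF shift])
    then have "v j = v k + of_int n * (2 * of_real pi)"
      by (simp only: fx fy)
    then have "cmod (v j - v k) = \<bar>of_int n\<bar> * (2 * pi)"
      by (simp add: norm_mult)
    moreover have "cmod (v j - v k) < 2"
    proof -
      have "dist (f a0) (v j) < 1" "dist (f a0) (v k) < 1"
        using vV(3)[of j] vV(3)[of k] by simp_all
      then show ?thesis
        using dist_triangle3[of "v j" "v k" "f a0"] by (simp add: dist_norm)
    qed
    moreover have "1 * (2 * pi) \<le> \<bar>of_int n\<bar> * (2 * pi)" if "n \<noteq> 0"
      using that by (intro mult_right_mono) auto
    ultimately have "n = 0" using pi_gt3 by linarith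
    then show ?thesis using n by simp
  qed
  define R where "R = max \<bar>Im a0\<bar> \<bar>Im b0\<bar> + r"
  have Im: "\<bar>Im x\<bar> < \<bar>Im c\<bar> + r" if "x \<in> ball c r" for x c
  proof -
    have "\<bar>Im x - Im c\<bar> \<le> cmod (x - c)" using abs_Im_le_cmod[of "x - c"] by simp
    moreover have "cmod (x - c) < r" using that by (simp add: dist_norm norm_minus_commute)
    ultimately show ?thesis by linarith
  qed
  show ?thesis
  proof (rule that[of a b R])
    show "\<forall>k. f (a k) = f (b k)" by (simp add: a(2) b(2))
    show "\<forall>k. \<bar>Im (a k)\<bar> < R \<and> \<bar>Im (b k)\<bar> < R"
    proof (intro allI conjI)
      show "\<bar>Im (a k)\<bar> < R" for k using Im[OF a(1)[of k]] by (simp add: R_def)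
      show "\<bar>Im (b k)\<bar> < R" for k using Im[OF b(1)[of k]] by (simp add: R_def)
    qed
    show "inj (\<lambda>k. exp (\<i> * a k))"
    proof (rule injI)
      fix j k assume "exp (\<i> * a j) = exp (\<i> * a k)"
      then have "a j = a k" by (rule close[OF _ a(2) a(2)])
      then have "v j = v k" using a(2) by metis
      then show "j = k" using v(1) by (simp add: inj_eq)
    qed
    show "\<forall>j k. exp (\<i> * a j) \<noteq> exp (\<i> * b k)"
    proof (intro allI notI)
      fix j k assume "exp (\<i> * a j) = exp (\<i> * b k)"
      then have "a j = b k" by (rule close[OF _ a(2) b(2)])
      then show False using a(1)[of j] b(1)[of k] disj by auto
    qed
  qed
qed

section \<open>The function \<open>w\<close> and the eigenfunctions\<close>

lemma strip_eq: "strip T = {z. - T < Im z} \<inter> {z. Im z < T}"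
  by (auto simp: strip_def)

lemma open_strip: "open (strip T)"
  unfolding strip_eq by (intro open_Int open_halfspace_Im_gt open_halfspace_Im_lt)

lemma convex_strip: "convex (strip T)"
  unfolding strip_eq by (intro convex_Int convex_halfspace_Im_gt convex_halfspace_Im_lt)

text \<open>Reality on the axis serves to make the constant \<open>C1 q\<close> a positive number.\<close>

locale real_periodic_exponent =
  fixes q :: "complex \<Rightarrow> complex"
  assumes entire: "q holomorphic_on UNIV"
    and periodic: "q (z + 2 * of_real pi) = q z"
    and real_on_axis: "q (of_real x) \<in> \<real>"
begin

abbreviation w where "w \<equiv> w_fun q"
abbreviation p where "p \<equiv> p_fun q"

lemma exp_q_continuous: "continuous_on A (\<lambda>x::real. exp (- q (of_real x)))"
  by (intro continuous_intros continuous_on_compose2[OF holomorphic_on_imp_continuous_on[OF entire]]) auto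

lemma C1_integral: "C1 q = 1 / (2 * of_real pi) * integral {0..2 * pi} (\<lambda>x. exp (- q (of_real x)))"
  unfolding C1_def
  by (simp add: set_borel_integral_eq_integral(2)[OF borel_integrable_atLeastAtMost'[OF exp_q_continuous]])

lemma C1_nonzero: "C1 q \<noteq> 0"
proof
  assume "C1 q = 0"
  then have zero: "integral {0..2 * pi} (\<lambda>x. exp (- q (of_real x))) = 0"
    by (simp add: C1_integral)
  have pi: "\<not> pi \<le> 0" using pi_gt_zero by linarith
  have "((\<lambda>x. exp (- q (of_real x))) has_integral 0) {0..2 * pi}"
    using integrable_integral[OF integrable_continuous_real[OF exp_q_continuous]] zero by metis
  from has_integral_linear[OF this bounded_linear_Re]
  have "((\<lambda>x. Re (exp (- q (of_real x)))) has_integral 0) (cbox 0 (2 * pi))"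
    by (simp add: o_def)
  moreover have "Re (exp (- q (of_real x))) > 0" for x
  proof -
    have "q (of_real x) = of_real (Re (q (of_real x)))"
      using real_on_axis by (simp add: of_real_Re)
    then have "exp (- q (of_real x)) = of_real (exp (- Re (q (of_real x))))"
      by (metis exp_of_real of_real_minus)
    then show ?thesis by simp
  qed
  ultimately have "Re (exp (- q (of_real 0))) = 0"
    by (intro has_integral_0_cbox_imp_0[where a = 0 and b = "2 * pi" and x = 0])
       (auto intro!: continuous_intros exp_q_continuous less_imp_le simp: pi)
  then show False using \<open>\<And>x. Re (exp (- q (of_real x))) > 0\<close>[of 0] by simp
qed

lemma p_nonzero: "p z \<noteq> 0"
  by (simp add: p_fun_def C1_nonzero)

lemma p_holomorphic: "p holomorphic_on A"
  unfolding p_fun_def using entire holomorphic_on_subset by (intro holomorphic_intros) blast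

lemma inverse_p_contour_integral:
  obtains F where "\<And>z. (F has_field_derivative 1 / p z) (at z)"
    "\<And>z. ((\<lambda>s. 1 / p s) has_contour_integral (F z - F 0)) (linepath 0 z)"
proof -
  have "(\<lambda>z. 1 / p z) holomorphic_on UNIV"
    by (intro holomorphic_intros p_holomorphic) (simp add: p_nonzero)
  then obtain F where F: "\<And>z. (F has_field_derivative 1 / p z) (at z)"
    using entire_primitive by blast
  have "((\<lambda>s. 1 / p s) has_contour_integral (F z - F 0)) (linepath 0 z)" for z
    using contour_integral_primitive[of UNIV F "\<lambda>z. 1 / p z" "linepath 0 z"] F by simp
  with F show ?thesis using that by blast
qed

lemma w_has_contour_integral: "((\<lambda>s. 1 / p s) has_contour_integral w z) (linepath 0 z)"
  using inverse_p_contour_integral contour_integral_unique unfolding w_fun_def by metis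

lemma w_has_derivative: "(w has_field_derivative 1 / p z) (at z)"
proof -
  obtain F where F: "\<And>z. (F has_field_derivative 1 / p z) (at z)"
    and c: "\<And>z. ((\<lambda>s. 1 / p s) has_contour_integral (F z - F 0)) (linepath 0 z)"
    using inverse_p_contour_integral by blast
  have "w = (\<lambda>z. F z - F 0)"
    using contour_integral_unique[OF c] by (simp add: w_fun_def fun_eq_iff)
  then show ?thesis
    using DERIV_diff[OF F DERIV_const[where k = "F 0"], of z] by simp
qed

lemma w_holomorphic: "w holomorphic_on A"
  using w_has_derivative by (meson field_differentiable_at_within field_differentiable_def holomorphic_onI)

text \<open>The constant \<open>C1 q\<close> is exactly the normalisation for which \<open>w\<close> gains \<open>2\<pi>\<close> over a period.\<close>

lemma w_2pi: "w (2 * of_real pi) = 2 * of_real pi"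
proof -
  have "((\<lambda>s. 1 / p s) has_contour_integral w (2 * of_real pi)) (linepath 0 (2 * of_real pi))"
    by (rule w_has_contour_integral)
  then have "((\<lambda>x. 1 / p (of_real x)) has_integral w (2 * of_real pi)) {0..2 * pi}"
    by (subst (asm) has_contour_integral_linepath_Reals_iff) auto
  moreover have "((\<lambda>x. (1 / C1 q) * exp (- q (of_real x))) has_integral
      (1 / C1 q) * integral {0..2 * pi} (\<lambda>x. exp (- q (of_real x)))) {0..2 * pi}"
    by (intro has_integral_mult_right integrable_integral integrable_continuous_real exp_q_continuous)
  moreover have "(\<lambda>x. 1 / p (of_real x)) = (\<lambda>x. (1 / C1 q) * exp (- q (of_real x)))"
    by (simp add: p_fun_def exp_minus field_simps)
  ultimately have "w (2 * of_real pi) = (1 / C1 q) * integral {0..2 * pi} (\<lambda>x. exp (- q (of_real x)))"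
    by (metis has_integral_unique)
  also have "integral {0..2 * pi} (\<lambda>x. exp (- q (of_real x))) = 2 * of_real pi * C1 q"
    by (simp add: C1_integral)
  finally show ?thesis using C1_nonzero by simp
qed

lemma w_shift: "w (z + 2 * of_real pi) = w z + 2 * of_real pi"
proof -
  have "w 0 = 0" by (simp add: w_fun_def)
  moreover have "1 / p (z + 2 * of_real pi) = 1 / p z" for z
    by (simp add: p_fun_def periodic)
  ultimately show ?thesis
    using quasiperiodic_primitive[OF w_has_derivative, of "2 * of_real pi" z 0] w_2pi by simp
qed

lemma y_has_derivative: "(y_fun q n has_field_derivative \<i> * of_int n / p z * y_fun q n z) (at z)"
  unfolding y_fun_def
  by (rule derivative_eq_intros w_has_derivative refl | simp)+

lemma y_entire_periodic: "entire_periodic (y_fun q n)"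
  unfolding entire_periodic_def y_fun_def w_shift
  by (intro conjI allI holomorphic_intros w_holomorphic exp_2pi_periodic)

text \<open>Since \<open>w' = 1/p\<close>, the solutions of \<open>p f' = \<mu> f\<close> on the strip are the multiples of \<open>exp (\<mu> * w z)\<close>.
  As \<open>w\<close> gains \<open>2\<pi>\<close> over a period, such a solution is periodic if and only if \<open>exp (2\<pi>\<mu>) = 1\<close>, that
  is, \<open>\<mu> = \<i> n\<close>.\<close>

lemma periodic_eigenfunction_iff:
  assumes T: "T > 0"
  shows "(\<exists>\<mu>. periodic_eigenfunction T p \<mu> f) \<longleftrightarrow>
    (\<exists>n c. c \<noteq> 0 \<and> (\<forall>z\<in>strip T. f z = c * y_fun q n z))"
proof -
  have "0 \<in> strip T" using T by (simp add: strip_def)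
  note strip = open_strip convex_strip this
  show ?thesis
  proof
    assume "\<exists>\<mu>. periodic_eigenfunction T p \<mu> f"
    then obtain \<mu> z0 where hol: "f holomorphic_on strip T"
      and per: "\<And>z. z \<in> strip T \<Longrightarrow> f (z + 2 * of_real pi) = f z"
      and z0: "z0 \<in> strip T" "f z0 \<noteq> 0"
      and ev: "\<And>z. z \<in> strip T \<Longrightarrow> p z * deriv f z = \<mu> * f z"
      unfolding periodic_eigenfunction_def by blast
    define g where "g = (\<lambda>z. f z * exp (- \<mu> * w z))"
    have dg: "(g has_field_derivative 0) (at z within strip T)" if z: "z \<in> strip T" for z
    proof -
      have df: "(f has_field_derivative \<mu> * f z / p z) (at z)"
        using holomorphic_derivI[OF hol strip(1) z] ev[OF z] p_nonzero
        by (metis nonzero_mult_div_cancel_left)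
      have "(g has_field_derivative (\<mu> * f z / p z * exp (- \<mu> * w z)
               + f z * (exp (- \<mu> * w z) * (- \<mu> * (1 / p z))))) (at z)"
        unfolding g_def
        by (rule derivative_eq_intros df w_has_derivative refl | simp)+
      then have "(g has_field_derivative 0) (at z)" by simp
      then show ?thesis by (rule has_field_derivative_at_within)
    qed
    obtain c where "\<And>z. z \<in> strip T \<Longrightarrow> g z = c"
      using has_field_derivative_zero_constant[OF strip(2) dg] by blast
    then have f: "f z = c * exp (\<mu> * w z)" if "z \<in> strip T" for z
      using that by (auto simp: g_def exp_minus field_simps)
    have c: "c \<noteq> 0" using f[OF z0(1)] z0(2) by auto
    have "exp (\<mu> * w (0 + 2 * of_real pi)) = exp (\<mu> * w 0)"
    proof -
      have "0 + 2 * of_real pi \<in> strip T" using T by (simp add: strip_def)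
      then show ?thesis using per[OF strip(3)] f[OF strip(3)] f c by (metis mult_left_cancel)
    qed
    then have "exp (\<mu> * (2 * of_real pi)) = 1"
      unfolding w_shift by (simp add: w_fun_def)
    then obtain n :: int where "\<mu> * (2 * of_real pi) = of_int (2 * n) * of_real pi * \<i>"
      using exp_eq[of "\<mu> * (2 * of_real pi)" 0] by auto
    then have "(2 * of_real pi) * \<mu> = (2 * of_real pi) * (\<i> * of_int n)"
      by (simp add: algebra_simps)
    then have "\<mu> = \<i> * of_int n"
      by (metis mult_left_cancel mult_eq_0_iff of_real_eq_0_iff pi_neq_zero zero_neq_numeral)
    then show "\<exists>n c. c \<noteq> 0 \<and> (\<forall>z\<in>strip T. f z = c * y_fun q n z)"
      using c f by (auto simp: y_fun_def)
  next
    assume "\<exists>n c. c \<noteq> 0 \<and> (\<forall>z\<in>strip T. f z = c * y_fun q n z)"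
    then obtain n c where c: "c \<noteq> 0" and f: "\<And>z. z \<in> strip T \<Longrightarrow> f z = c * y_fun q n z" by blast
    have df: "(f has_field_derivative c * (\<i> * of_int n / p z * y_fun q n z)) (at z)"
      if z: "z \<in> strip T" for z
      by (rule has_field_derivative_transform_within_open[OF DERIV_cmult[OF y_has_derivative] strip(1) z])
         (simp add: f)
    have "periodic_eigenfunction T p (\<i> * of_int n) f"
      unfolding periodic_eigenfunction_def
    proof (intro conjI ballI)
      show "f holomorphic_on strip T"
        using df by (meson field_differentiable_at_within field_differentiable_def holomorphic_onI)
      show "f (z + 2 * of_real pi) = f z" if "z \<in> strip T" for z
      proof -
        have "z + 2 * of_real pi \<in> strip T" using that by (simp add: strip_def)
        then show ?thesis using that by (simp add: f entire_periodic_shift[OF y_entire_periodic])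
      qed
      show "\<exists>z\<in>strip T. f z \<noteq> 0"
        using strip(3) c f by (auto simp: y_fun_def intro!: bexI[of _ 0])
      show "p z * deriv f z = \<i> * of_int n * f z" if "z \<in> strip T" for z
        using DERIV_imp_deriv[OF df[OF that]] f[OF that] p_nonzero[of z] by simp
    qed
    then show "\<exists>\<mu>. periodic_eigenfunction T p \<mu> f" by blast
  qed
qed

text \<open>An injective \<open>w\<close> would be affine, so \<open>w' = 1/p\<close> would be constant, and with it \<open>exp q\<close> and \<open>q\<close>.\<close>

lemma w_not_injective:
  assumes "\<not> q constant_on UNIV"
  shows "\<not> inj w"
proof
  assume inj: "inj w"
  have dw: "deriv w z = 1 / p z" for z
    by (rule DERIV_imp_deriv[OF w_has_derivative])
  have "deriv w 0 \<noteq> 0" by (simp add: dw p_nonzero)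
  from injective_entire_derivative_constant[OF w_holomorphic inj this]
  obtain c where c: "\<And>z. deriv w z = c" by blast
  have "p z = 1 / c" for z
    using c[of z] p_nonzero[of z] by (auto simp: dw)
  then have e: "exp (q z) = exp (q 0)" for z
    using C1_nonzero unfolding p_fun_def by (metis mult_left_cancel)
  have "(q has_field_derivative 0) (at z)" for z
  proof -
    have dq: "(q has_field_derivative deriv q z) (at z)"
      using entire holomorphic_derivI by blast
    have "((\<lambda>z. exp (q z)) has_field_derivative exp (q z) * deriv q z) (at z)"
      by (rule derivative_eq_intros dq refl)+
    moreover have "((\<lambda>z. exp (q z)) has_field_derivative 0) (at z)"
    proof -
      have "(\<lambda>z. exp (q z)) = (\<lambda>z. exp (q 0))" using e by (rule ext)
      then show ?thesis by (metis DERIV_const)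
    qed
    ultimately have "exp (q z) * deriv q z = 0" by (rule DERIV_unique)
    then show ?thesis using dq by simp
  qed
  then have "q z = q 0" for z by (rule entire_constant_if_derivative_zero)
  then have "q constant_on UNIV" by (auto simp: constant_on_def)
  with assms show False by blast
qed

end

section \<open>Boundary values and the inner product\<close>

definition closed_strip :: "real \<Rightarrow> complex set" where
  "closed_strip T = {z. - T \<le> Im z \<and> Im z \<le> T}"

text \<open>The extension is a separate function because elements of \<open>H2 T\<close> are represented by functions that
  are zero outside the open strip, hence in general discontinuous at its edges.\<close>

definition continuous_extension ::
    "real \<Rightarrow> (complex \<Rightarrow> complex) \<Rightarrow> (complex \<Rightarrow> complex) \<Rightarrow> bool" where
  "continuous_extension T f F \<longleftrightarrow>
     continuous_on (closed_strip T) F \<and> (\<forall>z\<in>strip T. f z = F z)"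

lemma strip_subset_closed_strip: "strip T \<subseteq> closed_strip T"
  by (auto simp: strip_def closed_strip_def)

lemma continuous_on_horizontal:
  assumes "continuous_on (closed_strip T) F" "- T \<le> \<tau>" "\<tau> \<le> T"
  shows "continuous_on A (\<lambda>x. F (Complex x \<tau>))"
proof (rule continuous_on_compose2[OF assms(1)])
  show "continuous_on A (\<lambda>x. Complex x \<tau>)"
    by (simp add: Complex_eq) (intro continuous_intros)
qed (use assms in \<open>auto simp: closed_strip_def\<close>)

lemma set_integrable_continuous:
  fixes f :: "real \<Rightarrow> 'a::{banach, second_countable_topology}"
  assumes "continuous_on UNIV f"
  shows "set_integrable lborel {a..b} f"
  using assms continuous_on_subset by (blast intro: borel_integrable_atLeastAtMost')

text \<open>The squared distance in L2 between the restrictions of \<open>F\<close> to the lines at heights \<open>\<tau>\<close> and \<open>h\<close> is a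
  continuous function of \<open>\<tau>\<close> on the closed interval, and it vanishes at \<open>h\<close>.\<close>

lemma is_boundary_value_extension:
  assumes ext: "continuous_extension T f F" and h: "h = T \<or> h = - T" and T: "T > 0"
  shows "is_boundary_value T f h (\<lambda>x. F (Complex x h))"
proof -
  have cF: "continuous_on (closed_strip T) F" and eq: "\<And>z. z \<in> strip T \<Longrightarrow> f z = F z"
    using ext by (auto simp: continuous_extension_def)
  have hT: "- T \<le> h" "h \<le> T" using h T by auto
  note hor = continuous_on_horizontal[OF cF]
  define \<phi> where "\<phi> = (\<lambda>\<tau>. integral (cbox 0 (2 * pi)) (\<lambda>x. (cmod (F (Complex x \<tau>) - F (Complex x h)))\<^sup>2))"
  have contF: "continuous_on ({-T..T} \<times> cbox 0 (2 * pi)) (\<lambda>u. F (Complex (snd u) (k (fst u))))"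
    if "k = (\<lambda>t. t) \<or> k = (\<lambda>t. h)" for k
  proof (rule continuous_on_compose2[OF cF])
    show "continuous_on ({-T..T} \<times> cbox 0 (2 * pi)) (\<lambda>u. Complex (snd u) (k (fst u)))"
      using that by (auto simp: Complex_eq intro!: continuous_intros)
  qed (use hT that in \<open>auto simp: closed_strip_def\<close>)
  have "continuous_on {-T..T} \<phi>"
    unfolding \<phi>_def
  proof (rule integral_continuous_on_param)
    show "continuous_on ({-T..T} \<times> cbox 0 (2 * pi))
            (\<lambda>(\<tau>, x). (cmod (F (Complex x \<tau>) - F (Complex x h)))\<^sup>2)"
      using contF[of "\<lambda>t. t"] contF[of "\<lambda>t. h"]
      by (auto simp: case_prod_beta intro!: continuous_intros)
  qed
  then have "(\<phi> \<longlongrightarrow> \<phi> h) (at h within {-T..T})"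
    using hT by (auto simp: continuous_on_def)
  moreover have "\<phi> h = 0" by (simp add: \<phi>_def)
  ultimately have lim: "(\<phi> \<longlongrightarrow> 0) (at h within {-T<..<T})"
    by (metis tendsto_within_subset greaterThanLessThan_subseteq_atLeastAtMost_iff order_refl)
  have int: "(LBINT x:{0..2 * pi}. (cmod (f (Complex x \<tau>) - F (Complex x h)))\<^sup>2) = \<phi> \<tau>"
    if "\<tau> \<in> {-T<..<T}" for \<tau>
  proof -
    have "(\<lambda>x. f (Complex x \<tau>)) = (\<lambda>x. F (Complex x \<tau>))"
      using that by (auto simp: eq strip_def)
    then have "(LBINT x:{0..2 * pi}. (cmod (f (Complex x \<tau>) - F (Complex x h)))\<^sup>2)
         = (LBINT x:{0..2 * pi}. (cmod (F (Complex x \<tau>) - F (Complex x h)))\<^sup>2)"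
      by metis
    also have "\<dots> = \<phi> \<tau>"
      unfolding \<phi>_def cbox_interval
      using that hT
      by (intro set_borel_integral_eq_integral set_integrable_continuous continuous_intros hor) auto
    finally show ?thesis .
  qed
  have "((\<lambda>\<tau>. LBINT x:{0..2 * pi}. (cmod (f (Complex x \<tau>) - F (Complex x h)))\<^sup>2) \<longlongrightarrow> 0)
          (at h within {-T<..<T})"
    by (rule Lim_transform_eventually[OF lim]) (auto simp: eventually_at_filter int)
  moreover have "(\<lambda>x. F (Complex x h)) \<in> borel_measurable borel"
    by (intro borel_measurable_continuous_onI hor hT)
  moreover have "set_integrable lborel {0..2 * pi} (\<lambda>x. (cmod (F (Complex x h)))\<^sup>2)"
    by (intro set_integrable_continuous continuous_intros hor hT)
  ultimately show ?thesis by (simp add: is_boundary_value_def)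
qed

lemma cmod_diff_square_le: "(cmod (a - b))\<^sup>2 \<le> 2 * (cmod (c - a))\<^sup>2 + 2 * (cmod (c - b))\<^sup>2"
proof -
  have "cmod (a - b) \<le> cmod (c - a) + cmod (c - b)"
    using norm_triangle_ineq4[of "c - b" "c - a"] by simp
  then have "(cmod (a - b))\<^sup>2 \<le> (cmod (c - a) + cmod (c - b))\<^sup>2"
    by (simp add: power_mono)
  also have "\<dots> \<le> 2 * (cmod (c - a))\<^sup>2 + 2 * (cmod (c - b))\<^sup>2"
    using zero_le_power2[of "cmod (c - a) - cmod (c - b)"] by (simp add: power2_eq_square algebra_simps)
  finally show ?thesis .
qed

lemma set_integrable_diff_square:
  fixes a b :: "real \<Rightarrow> complex"
  assumes [measurable]: "a \<in> borel_measurable borel" "b \<in> borel_measurable borel"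
    and "set_integrable lborel A (\<lambda>x. (cmod (a x))\<^sup>2)" "set_integrable lborel A (\<lambda>x. (cmod (b x))\<^sup>2)"
    and [measurable]: "A \<in> sets borel"
  shows "set_integrable lborel A (\<lambda>x. (cmod (a x - b x))\<^sup>2)"
proof (rule set_integrable_bound)
  show "set_integrable lborel A (\<lambda>x. 2 * (cmod (a x))\<^sup>2 + 2 * (cmod (b x))\<^sup>2)"
    using assms by (intro set_integral_add set_integrable_mult_right) auto
  show "set_borel_measurable lborel A (\<lambda>x. (cmod (a x - b x))\<^sup>2)"
    unfolding set_borel_measurable_def by measurable
  show "AE x in lborel. x \<in> A \<longrightarrow> norm ((cmod (a x - b x))\<^sup>2) \<le> norm (2 * (cmod (a x))\<^sup>2 + 2 * (cmod (b x))\<^sup>2)"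
    using cmod_diff_square_le[of _ _ 0] by (auto simp del: power2_diff)
qed

text \<open>Two limits in L2 of the same family are at distance zero.\<close>

lemma boundary_value_unique_AE:
  assumes b: "is_boundary_value T f h b" and b': "is_boundary_value T f h b'"
    and f: "continuous_on (strip T) f" and h: "h = T \<or> h = - T" and T: "T > 0"
  shows "AE x \<in> {0..2 * pi} in lborel. b x = b' x"
proof -
  let ?P = "{0..2 * pi}"
  define D where "D = (\<lambda>x. (cmod (b x - b' x))\<^sup>2)"
  have mb [measurable]: "b \<in> borel_measurable borel" "b' \<in> borel_measurable borel"
    and ib: "set_integrable lborel ?P (\<lambda>x. (cmod (b x))\<^sup>2)" "set_integrable lborel ?P (\<lambda>x. (cmod (b' x))\<^sup>2)"
    and lim: "((\<lambda>\<tau>. LBINT x:?P. (cmod (f (Complex x \<tau>) - b x))\<^sup>2) \<longlongrightarrow> 0) (at h within {-T<..<T})"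
      "((\<lambda>\<tau>. LBINT x:?P. (cmod (f (Complex x \<tau>) - b' x))\<^sup>2) \<longlongrightarrow> 0) (at h within {-T<..<T})"
    using b b' by (auto simp: is_boundary_value_def)
  have intD: "set_integrable lborel ?P D"
    unfolding D_def by (intro set_integrable_diff_square mb ib) auto
  have le: "(LBINT x:?P. D x) \<le> 2 * (LBINT x:?P. (cmod (f (Complex x \<tau>) - b x))\<^sup>2)
      + 2 * (LBINT x:?P. (cmod (f (Complex x \<tau>) - b' x))\<^sup>2)" if "\<tau> \<in> {-T<..<T}" for \<tau>
  proof -
    have c: "continuous_on UNIV (\<lambda>x. f (Complex x \<tau>))"
    proof (rule continuous_on_compose2[OF f])
      show "continuous_on UNIV (\<lambda>x. Complex x \<tau>)"
        by (simp add: Complex_eq) (intro continuous_intros)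
    qed (use that in \<open>auto simp: strip_def\<close>)
    have m: "(\<lambda>x. f (Complex x \<tau>)) \<in> borel_measurable borel"
      by (intro borel_measurable_continuous_onI c)
    have i: "set_integrable lborel ?P (\<lambda>x. (cmod (f (Complex x \<tau>)))\<^sup>2)"
      by (intro set_integrable_continuous continuous_intros c)
    note ii = set_integrable_diff_square[OF m mb(1) i ib(1)] set_integrable_diff_square[OF m mb(2) i ib(2)]
    have "(LBINT x:?P. D x) \<le> (LBINT x:?P. 2 * (cmod (f (Complex x \<tau>) - b x))\<^sup>2
              + 2 * (cmod (f (Complex x \<tau>) - b' x))\<^sup>2)"
      using ii unfolding D_def
      by (intro set_integral_mono intD[unfolded D_def] set_integral_add set_integrable_mult_right cmod_diff_square_le) auto
    also have "\<dots> = 2 * (LBINT x:?P. (cmod (f (Complex x \<tau>) - b x))\<^sup>2)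
      + 2 * (LBINT x:?P. (cmod (f (Complex x \<tau>) - b' x))\<^sup>2)"
      using ii by (subst set_integral_add) (auto intro!: set_integrable_mult_right)
    finally show ?thesis .
  qed
  have "h islimpt {-T<..<T}"
    using h T islimpt_greaterThanLessThan1[of "-T" T] islimpt_greaterThanLessThan2[of "-T" T] by auto
  then have nt: "at h within {-T<..<T} \<noteq> bot"
    by (simp add: trivial_limit_within)
  have "(LBINT x:?P. D x) \<le> 2 * 0 + 2 * 0"
    by (rule tendsto_lowerbound[OF tendsto_add[OF tendsto_mult_left[OF lim(1)] tendsto_mult_left[OF lim(2)]] _ nt])
       (auto simp: eventually_at_filter le)
  moreover have "0 \<le> (LBINT x:?P. D x)"
    unfolding set_lebesgue_integral_def D_def by (intro Bochner_Integration.integral_nonneg) auto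
  ultimately have "integral\<^sup>L lborel (\<lambda>x. indicator ?P x *\<^sub>R D x) = 0"
    by (simp add: set_lebesgue_integral_def)
  then have "AE x in lborel. indicator ?P x *\<^sub>R D x = 0"
    using integral_nonneg_eq_0_iff_AE[OF intD[unfolded set_integrable_def]] by (auto simp: D_def)
  then show ?thesis
    by eventually_elim (auto simp: D_def)
qed

lemma continuous_extension_continuous: "continuous_extension T f F \<Longrightarrow> continuous_on (strip T) f"
  unfolding continuous_extension_def
  by (rule continuous_on_eq[OF continuous_on_subset]) (auto simp: strip_def closed_strip_def)

lemma boundary_value_extension:
  assumes ext: "continuous_extension T f F" and h: "h = T \<or> h = - T" and T: "T > 0"
  shows "boundary_value T f h \<in> borel_measurable borel"
    and "AE x \<in> {0..2 * pi} in lborel. boundary_value T f h x = F (Complex x h)"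
proof -
  have *: "is_boundary_value T f h (boundary_value T f h)"
    unfolding boundary_value_def
    by (rule someI[of "is_boundary_value T f h", OF is_boundary_value_extension[OF assms]])
  then show "boundary_value T f h \<in> borel_measurable borel" by (simp add: is_boundary_value_def)
  show "AE x \<in> {0..2 * pi} in lborel. boundary_value T f h x = F (Complex x h)"
    by (rule boundary_value_unique_AE[OF * is_boundary_value_extension[OF assms]
          continuous_extension_continuous[OF ext] h T])
qed

text \<open>For functions continuous up to the edges, the arbitrary choice in \<open>boundary_value\<close> disappears.\<close>

lemma inner_H_extension:
  assumes f: "continuous_extension T f F" and g: "continuous_extension T g G" and T: "T > 0"
  shows "inner_H T f g = 1 / (4 * of_real pi) *
    (integral {0..2 * pi} (\<lambda>x. F (Complex x T) * cnj (G (Complex x T)))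
     + integral {0..2 * pi} (\<lambda>x. F (Complex x (- T)) * cnj (G (Complex x (- T)))))"
proof -
  have c: "continuous_on UNIV (\<lambda>x. F (Complex x h))" "continuous_on UNIV (\<lambda>x. G (Complex x h))"
    if "h = T \<or> h = - T" for h
    using f g T that by (auto simp: continuous_extension_def intro!: continuous_on_horizontal)
  have m [measurable]: "(\<lambda>x. F (Complex x h)) \<in> borel_measurable borel"
      "(\<lambda>x. G (Complex x h)) \<in> borel_measurable borel" if "h = T \<or> h = - T" for h
    using c[OF that] by (auto intro: borel_measurable_continuous_onI)
  have [measurable]: "cnj \<in> borel_measurable borel"
    by (intro borel_measurable_continuous_onI continuous_intros)
  have i: "(\<lambda>x. F (Complex x h) * cnj (G (Complex x h))) integrable_on {0..2 * pi}"
    if "h = T \<or> h = - T" for h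
    using c[OF that]
    by (intro integrable_continuous_real continuous_intros) (auto intro: continuous_on_subset)
  note bf = boundary_value_extension[OF f _ T] and bg = boundary_value_extension[OF g _ T]
  have "(LBINT x:{0..2 * pi}.
        boundary_value T f T x * cnj (boundary_value T g T x)
        + boundary_value T f (- T) x * cnj (boundary_value T g (- T) x))
     = (LBINT x:{0..2 * pi}. F (Complex x T) * cnj (G (Complex x T))
        + F (Complex x (- T)) * cnj (G (Complex x (- T))))"
  proof (rule set_lebesgue_integral_cong_AE)
    show "(\<lambda>x. boundary_value T f T x * cnj (boundary_value T g T x)
        + boundary_value T f (- T) x * cnj (boundary_value T g (- T) x)) \<in> borel_measurable lborel"
      using bf(1)[of T] bf(1)[of "- T"] bg(1)[of T] bg(1)[of "- T"] by measurable
    show "(\<lambda>x. F (Complex x T) * cnj (G (Complex x T))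
        + F (Complex x (- T)) * cnj (G (Complex x (- T)))) \<in> borel_measurable lborel"
      using m[of T] m[of "- T"] by measurable
    show "AE x\<in>{0..2 * pi} in lborel.
       boundary_value T f T x * cnj (boundary_value T g T x) +
       boundary_value T f (- T) x * cnj (boundary_value T g (- T) x) =
       F (Complex x T) * cnj (G (Complex x T)) +
       F (Complex x (- T)) * cnj (G (Complex x (- T)))"
      using bf(2)[of T, simplified] bf(2)[of "- T", simplified]
        bg(2)[of T, simplified] bg(2)[of "- T", simplified]
      by eventually_elim auto
  qed auto
  also have "\<dots> = integral {0..2 * pi} (\<lambda>x. F (Complex x T) * cnj (G (Complex x T))
        + F (Complex x (- T)) * cnj (G (Complex x (- T))))"
    using c by (intro set_borel_integral_eq_integral set_integrable_continuous continuous_intros) auto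
  also have "\<dots> = integral {0..2 * pi} (\<lambda>x. F (Complex x T) * cnj (G (Complex x T)))
     + integral {0..2 * pi} (\<lambda>x. F (Complex x (- T)) * cnj (G (Complex x (- T))))"
    using i by (intro Henstock_Kurzweil_Integration.integral_add) auto
  finally show ?thesis by (simp add: inner_H_def)
qed

section \<open>Reproducing kernels\<close>

definition kernel_term :: "real \<Rightarrow> complex \<Rightarrow> int \<Rightarrow> complex \<Rightarrow> complex" where
  "kernel_term T a n z = exp (\<i> * of_int n * (z - cnj a)) / of_real (cosh (2 * of_int n * T))"

text \<open>The exponentials \<open>exp (\<i> * n * z)\<close> are orthogonal with squared norm \<open>cosh (2 * n * T)\<close>, so the sum of
  these terms is the reproducing kernel of \<open>H2 T\<close> at the point \<open>a\<close>.\<close>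

definition kernel_series :: "real \<Rightarrow> complex \<Rightarrow> complex \<Rightarrow> complex" where
  "kernel_series T a z = (\<Sum>\<^sub>\<infinity>n. kernel_term T a n z)"

definition kernel :: "real \<Rightarrow> complex \<Rightarrow> complex \<Rightarrow> complex" where
  "kernel T a z = (if z \<in> strip T then kernel_series T a z else 0)"

lemma exp_abs_le_cosh: "exp \<bar>x\<bar> \<le> 2 * cosh (x::real)"
  by (cases "x \<ge> 0") (auto simp: cosh_def)

lemma exp_div_cosh_le:
  fixes x :: real
  assumes "\<bar>s\<bar> \<le> 2 * T - d" "T > 0"
  shows "exp (- x * s) / cosh (2 * x * T) \<le> 2 * exp (- d * \<bar>x\<bar>)"
proof -
  have "- x * s \<le> \<bar>x\<bar> * \<bar>s\<bar>"
    using abs_ge_self[of "- x * s"] by (simp add: abs_mult)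
  also have "\<dots> \<le> \<bar>x\<bar> * (2 * T - d)"
    using assms(1) by (intro mult_left_mono) auto
  also have "\<dots> = - d * \<bar>x\<bar> + \<bar>2 * x * T\<bar>"
    using assms(2) by (simp add: abs_mult algebra_simps)
  finally have "exp (- x * s) \<le> exp (- d * \<bar>x\<bar>) * exp \<bar>2 * x * T\<bar>"
    by (simp add: exp_add[symmetric])
  also have "\<dots> \<le> exp (- d * \<bar>x\<bar>) * (2 * cosh (2 * x * T))"
    by (intro mult_left_mono exp_abs_le_cosh) auto
  finally show ?thesis
    using cosh_real_pos[of "2 * x * T"] by (simp add: divide_le_eq mult_ac)
qed

lemma norm_kernel_term:
  "cmod (kernel_term T a n z) = exp (- of_int n * (Im z + Im a)) / cosh (2 * of_int n * T)"
  using norm_exp_int[of n "z - cnj a"] by (simp add: kernel_term_def norm_divide)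

text \<open>The reciprocal of the denominator decays like \<open>exp (- 2 * T * \<bar>n\<bar>)\<close> while the numerator grows at most like
  \<open>exp ((T + \<bar>Im a\<bar>) * \<bar>n\<bar>)\<close>. For \<open>a\<close> in the open strip this bound is summable, uniformly up to the
  edges, so the kernels extend continuously to the closed strip.\<close>

lemma norm_kernel_term_le:
  assumes "z \<in> closed_strip T" "T > 0"
  shows "cmod (kernel_term T a n z) \<le> 2 * exp (- (T - \<bar>Im a\<bar>) * \<bar>of_int n\<bar>)"
  unfolding norm_kernel_term
  by (rule exp_div_cosh_le) (use assms in \<open>auto simp: closed_strip_def\<close>)

lemma kernel_bound_summable:
  assumes "a \<in> strip T"
  shows "(\<lambda>n::int. c * exp (- (T - \<bar>Im a\<bar>) * \<bar>of_int n\<bar>)) summable_on UNIV"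
  using assms by (intro summable_on_cmult_right summable_on_exp_abs_int) (auto simp: strip_def)

lemma kernel_series_has_sum:
  assumes "a \<in> strip T" "T > 0" "z \<in> closed_strip T"
  shows "((\<lambda>n. kernel_term T a n z) has_sum kernel_series T a z) UNIV"
  unfolding kernel_series_def
proof (rule has_sum_infsum, rule abs_summable_summable)
  show "(\<lambda>n. norm (kernel_term T a n z)) summable_on UNIV"
    by (rule summable_on_comparison_test[OF kernel_bound_summable[OF assms(1), of 2]])
       (use norm_kernel_term_le[OF assms(3,2)] in auto)
qed

lemma kernel_series_uniform_limit:
  assumes "a \<in> strip T" "T > 0"
  shows "uniform_limit (closed_strip T) (\<lambda>X z. \<Sum>n\<in>X. kernel_term T a n z)
           (kernel_series T a) (finite_subsets_at_top UNIV)"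
  unfolding kernel_series_def
  by (rule Weierstrass_m_test_general[OF norm_kernel_term_le[OF _ assms(2)] kernel_bound_summable[OF assms(1)]])

lemma kernel_term_holomorphic: "kernel_term T a n holomorphic_on A"
  unfolding kernel_term_def by (intro holomorphic_intros) (simp add: less_imp_neq[OF cosh_real_pos, symmetric])

lemma kernel_series_continuous:
  assumes "a \<in> strip T" "T > 0"
  shows "continuous_on (closed_strip T) (kernel_series T a)"
  by (rule uniform_limit_theorem[OF _ kernel_series_uniform_limit[OF assms]])
     (intro always_eventually allI holomorphic_on_imp_continuous_on holomorphic_on_sum
        kernel_term_holomorphic, simp)

lemma kernel_series_holomorphic:
  assumes "a \<in> strip T" "T > 0"
  shows "kernel_series T a holomorphic_on strip T"
proof (rule holomorphic_onI)
  fix z assume "z \<in> strip T"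
  then obtain r where r: "r > 0" "cball z r \<subseteq> strip T"
    using open_strip open_contains_cball by blast
  have ev: "\<forall>\<^sub>F X in finite_subsets_at_top UNIV. continuous_on (cball z r) (\<lambda>z. \<Sum>n\<in>X. kernel_term T a n z)
        \<and> (\<lambda>z. \<Sum>n\<in>X. kernel_term T a n z) holomorphic_on ball z r"
    by (intro always_eventually allI conjI holomorphic_on_imp_continuous_on holomorphic_on_sum
          kernel_term_holomorphic)
  have lim: "uniform_limit (cball z r) (\<lambda>X z. \<Sum>n\<in>X. kernel_term T a n z)
        (kernel_series T a) (finite_subsets_at_top UNIV)"
    by (rule uniform_limit_on_subset[OF kernel_series_uniform_limit[OF assms]])
       (use r(2) strip_subset_closed_strip in blast)
  have "kernel_series T a holomorphic_on ball z r"
    by (rule holomorphic_uniform_limit[OF ev lim]) simp_all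
  then have "kernel_series T a field_differentiable at z"
    by (rule holomorphic_on_imp_differentiable_at) (use r(1) in simp_all)
  then show "kernel_series T a field_differentiable at z within strip T"
    by (rule field_differentiable_at_within)
qed

lemma kernel_extension:
  assumes "a \<in> strip T" "T > 0"
  shows "continuous_extension T (kernel T a) (kernel_series T a)"
  using kernel_series_continuous[OF assms] by (simp add: continuous_extension_def kernel_def)

lemma kernel_term_shift: "kernel_term T a n (z + 2 * of_real pi) = kernel_term T a n z"
proof -
  have "exp (\<i> * of_int n * (z + 2 * of_real pi - cnj a)) = exp (\<i> * of_int n * (z - cnj a))"
    using exp_2pi_periodic[of n "z - cnj a"] by (simp add: algebra_simps)
  then show ?thesis by (simp only: kernel_term_def)
qed

lemma kernel_in_H2:
  assumes a: "a \<in> strip T" and T: "T > 0"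
  shows "kernel T a \<in> H2 T"
proof -
  have hol: "kernel T a holomorphic_on strip T"
    by (rule holomorphic_transform[OF kernel_series_holomorphic[OF assms]]) (simp add: kernel_def)
  have per: "kernel T a (z + 2 * of_real pi) = kernel T a z" for z
    by (simp add: kernel_def strip_def kernel_series_def kernel_term_shift)
  define c where "c = (\<lambda>n. kernel_term T a n 0)"
  have c: "c n * exp (\<i> * of_int n * z) = kernel_term T a n z" for n z
  proof -
    have "exp (\<i> * of_int n * (0 - cnj a)) * exp (\<i> * of_int n * z) = exp (\<i> * of_int n * (z - cnj a))"
      unfolding mult_exp_exp by (rule arg_cong[of _ _ exp]) (simp add: algebra_simps)
    then show ?thesis by (simp add: c_def kernel_term_def)
  qed
  have sum: "((\<lambda>n. c n * exp (\<i> * of_int n * z)) has_sum kernel T a z) UNIV" if "z \<in> strip T" for z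
    unfolding c using kernel_series_has_sum[OF assms, of z] that strip_subset_closed_strip
    by (auto simp: kernel_def)
  have norm: "(\<lambda>n. (cmod (c n))\<^sup>2 * cosh (2 * of_int n * T)) summable_on UNIV"
  proof (rule summable_on_comparison_test)
    show "(\<lambda>n::int. 2 * exp (- (2 * (T - \<bar>Im a\<bar>)) * \<bar>of_int n\<bar>)) summable_on UNIV"
      using a by (intro summable_on_cmult_right summable_on_exp_abs_int) (auto simp: strip_def)
    fix n :: int
    have "cosh (2 * of_int n * T) > 0" by (rule cosh_real_pos)
    then have "(cmod (c n))\<^sup>2 * cosh (2 * of_int n * T) = (exp (- of_int n * Im a))\<^sup>2 / cosh (2 * of_int n * T)"
      by (simp add: c_def norm_kernel_term power2_eq_square)
    also have "\<dots> = exp (- of_int n * (2 * Im a)) / cosh (2 * of_int n * T)"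
      by (simp add: power2_eq_square mult_exp_exp)
    also have "\<dots> \<le> 2 * exp (- (2 * (T - \<bar>Im a\<bar>)) * \<bar>of_int n\<bar>)"
      by (rule exp_div_cosh_le) (use T in auto)
    finally show "(cmod (c n))\<^sup>2 * cosh (2 * of_int n * T) \<le> 2 * exp (- (2 * (T - \<bar>Im a\<bar>)) * \<bar>of_int n\<bar>)" .
    show "0 \<le> (cmod (c n))\<^sup>2 * cosh (2 * of_int n * T)"
      by (simp add: less_imp_le cosh_real_pos)
  qed
  show ?thesis
    unfolding H2_def
    using hol per sum norm by (auto simp: kernel_def)
qed

lemma has_sum_integral:
  fixes f :: "int \<Rightarrow> real \<Rightarrow> complex"
  assumes cont: "\<And>n. continuous_on {a..b} (f n)"
    and le: "\<And>n x. x \<in> {a..b} \<Longrightarrow> cmod (f n x) \<le> M n" and M: "M summable_on UNIV"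
    and sum: "\<And>x. x \<in> {a..b} \<Longrightarrow> ((\<lambda>n. f n x) has_sum s x) UNIV"
  shows "((\<lambda>n. integral {a..b} (f n)) has_sum integral {a..b} s) UNIV"
proof -
  have "uniform_limit {a..b} (\<lambda>X x. \<Sum>n\<in>X. f n x) s (finite_subsets_at_top UNIV)"
    by (rule Weierstrass_m_test_general'[OF le sum M])
  from uniform_limit_integral[OF this continuous_on_sum[OF cont]]
  obtain I J where I: "\<And>X. ((\<lambda>x. \<Sum>n\<in>X. f n x) has_integral I X) {a..b}"
    and J: "(s has_integral J) {a..b}" and lim: "(I \<longlongrightarrow> J) (finite_subsets_at_top UNIV)"
    by (metis finite_subsets_at_top_neq_bot)
  have "I X = (\<Sum>n\<in>X. integral {a..b} (f n))" if "finite X" for X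
    using integral_unique[OF I, of X] that
    by (subst (asm) integral_sum) (auto intro: integrable_continuous_real cont)
  then have "((\<lambda>X. \<Sum>n\<in>X. integral {a..b} (f n)) \<longlongrightarrow> J) (finite_subsets_at_top UNIV)"
    by (intro Lim_transform_eventually[OF lim]) (auto simp: eventually_finite_subsets_at_top)
  then show ?thesis
    using integral_unique[OF J] by (simp add: has_sum_def)
qed

text \<open>On the line at height \<open>h\<close> one has \<open>cnj z = z - 2 * \<i> * h\<close>, so conjugation produces the holomorphic
  exponential of a Fourier coefficient, up to a constant factor.\<close>

lemma cnj_kernel_term:
  "cnj (kernel_term T a n (Complex x h)) =
     exp (\<i> * of_int n * a) * of_real (exp (- 2 * of_int n * h) / cosh (2 * of_int n * T))
       * exp (- \<i> * of_int n * Complex x h)"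
proof -
  have "cnj (exp (\<i> * of_int n * (Complex x h - cnj a))) = exp (- \<i> * of_int n * (cnj (Complex x h) - a))"
    by (simp add: exp_cnj)
  also have "\<dots> = exp (\<i> * of_int n * a) * exp (of_real (- 2 * of_int n * h)) * exp (- \<i> * of_int n * Complex x h)"
    unfolding mult_exp_exp
    by (rule arg_cong[of _ _ exp]) (simp add: Complex_eq algebra_simps)
  finally show ?thesis
    unfolding kernel_term_def complex_cnj_divide complex_cnj_complex_of_real exp_of_real of_real_divide
    by simp
qed

lemma has_sum_line_integral:
  assumes Y: "entire_periodic Y" and a: "a \<in> strip T" and T: "T > 0" and h: "h = T \<or> h = - T"
  shows "((\<lambda>n. (2 * of_real pi) * (fourier_coeff Y n * exp (\<i> * of_int n * a))
             * of_real (exp (- 2 * of_int n * h) / cosh (2 * of_int n * T)))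
     has_sum integral {0..2 * pi} (\<lambda>x. Y (Complex x h) * cnj (kernel_series T a (Complex x h)))) UNIV"
proof -
  have line: "Complex x h \<in> closed_strip T" for x
    using h T by (auto simp: closed_strip_def)
  have cY: "continuous_on A (\<lambda>x. Y (Complex x h))" for A
    by (rule continuous_on_horizontal[OF entire_periodic_continuous[OF Y]]) (use h T in auto)
  have "compact ((\<lambda>x. Y (Complex x h)) ` {0..2 * pi})"
    by (intro compact_continuous_image cY) auto
  then have "\<exists>M. \<forall>x\<in>{0..2 * pi}. cmod (Y (Complex x h)) \<le> M"
    by (auto simp: bounded_iff dest!: compact_imp_bounded)
  then obtain M where M: "\<And>x. x \<in> {0..2 * pi} \<Longrightarrow> cmod (Y (Complex x h)) \<le> M"
    by blast
  have "cmod (Y (Complex 0 h)) \<le> M" by (rule M) simp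
  then have M0: "M \<ge> 0" by (rule order_trans[OF norm_ge_zero])
  have ck: "continuous_on A (\<lambda>x. kernel_term T a n (Complex x h))" for n A
    by (rule continuous_on_horizontal[OF holomorphic_on_imp_continuous_on[OF kernel_term_holomorphic]])
       (use h T in auto)
  have "((\<lambda>n. integral {0..2 * pi} (\<lambda>x. Y (Complex x h) * cnj (kernel_term T a n (Complex x h))))
     has_sum integral {0..2 * pi} (\<lambda>x. Y (Complex x h) * cnj (kernel_series T a (Complex x h)))) UNIV"
  proof (rule has_sum_integral)
    show "continuous_on {0..2 * pi} (\<lambda>x. Y (Complex x h) * cnj (kernel_term T a n (Complex x h)))" for n
      by (intro continuous_on_mult continuous_on_cnj cY ck)
    show "cmod (Y (Complex x h) * cnj (kernel_term T a n (Complex x h)))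
        \<le> M * (2 * exp (- (T - \<bar>Im a\<bar>) * \<bar>of_int n\<bar>))" if "x \<in> {0..2 * pi}" for n x
      unfolding norm_mult complex_mod_cnj
      by (rule mult_mono[OF M[OF that] norm_kernel_term_le[OF line T] M0 norm_ge_zero])
    show "(\<lambda>n::int. M * (2 * exp (- (T - \<bar>Im a\<bar>) * \<bar>of_int n\<bar>))) summable_on UNIV"
      by (intro summable_on_cmult_right kernel_bound_summable[OF a])
    show "((\<lambda>n. Y (Complex x h) * cnj (kernel_term T a n (Complex x h)))
        has_sum Y (Complex x h) * cnj (kernel_series T a (Complex x h))) UNIV" for x
      using has_sum_cmult_right[OF has_sum_cnj_iff[THEN iffD2, OF kernel_series_has_sum[OF a T line]]] .
  qed
  moreover have "integral {0..2 * pi} (\<lambda>x. Y (Complex x h) * cnj (kernel_term T a n (Complex x h)))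
      = (2 * of_real pi) * (fourier_coeff Y n * exp (\<i> * of_int n * a))
             * of_real (exp (- 2 * of_int n * h) / cosh (2 * of_int n * T))" for n
  proof -
    define C where "C = exp (\<i> * of_int n * a) * of_real (exp (- 2 * of_int n * h) / cosh (2 * of_int n * T))"
    have "(\<lambda>x. Y (Complex x h) * cnj (kernel_term T a n (Complex x h)))
        = (\<lambda>x. C * (Y (Complex x h) * exp (- \<i> * of_int n * Complex x h)))"
      unfolding cnj_kernel_term C_def by (simp only: mult_ac)
    then have "integral {0..2 * pi} (\<lambda>x. Y (Complex x h) * cnj (kernel_term T a n (Complex x h)))
       = C * integral {0..2 * pi} (\<lambda>x. Y (Complex x h) * exp (- \<i> * of_int n * Complex x h))"
      by (simp only: integral_mult_right)
    also have "\<dots> = C * ((2 * of_real pi) * fourier_coeff Y n)"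
      unfolding fourier_coeff_horizontal[OF Y, of n h] by simp
    finally show ?thesis by (simp only: C_def mult_ac)
  qed
  ultimately show ?thesis by (simp only:)
qed

text \<open>Let \<open>c n\<close> be the \<open>n\<close>-th term of the Fourier series of \<open>Y\<close> at \<open>a\<close>. Termwise integration gives the
  sum of \<open>2\<pi> * c n * exp (- 2 * n * T) / cosh (2 * n * T)\<close> on the upper edge and the same with \<open>-T\<close> in
  the exponential on the lower one. These terms add up to \<open>4\<pi> * c n\<close>, and the factor \<open>4\<pi>\<close> is the
  normalisation of the inner product.\<close>

lemma inner_H_kernel:
  assumes Y: "entire_periodic Y" and a: "a \<in> strip T" and T: "T > 0"
  shows "inner_H T Y (kernel T a) = Y a"
proof -
  define I where "I = (\<lambda>h. integral {0..2 * pi} (\<lambda>x. Y (Complex x h) * cnj (kernel_series T a (Complex x h))))"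
  define c where "c = (\<lambda>n. fourier_coeff Y n * exp (\<i> * of_int n * a))"
  have "((\<lambda>n. (2 * of_real pi) * c n * of_real (exp (- 2 * of_int n * T) / cosh (2 * of_int n * T))
       + (2 * of_real pi) * c n * of_real (exp (- 2 * of_int n * (- T)) / cosh (2 * of_int n * T)))
     has_sum I T + I (- T)) UNIV"
    unfolding I_def c_def by (intro has_sum_add has_sum_line_integral Y a T) auto
  moreover have "(2 * of_real pi) * c n * of_real (exp (- 2 * of_int n * T) / cosh (2 * of_int n * T))
       + (2 * of_real pi) * c n * of_real (exp (- 2 * of_int n * (- T)) / cosh (2 * of_int n * T))
     = (4 * of_real pi) * c n" for n
  proof -
    have "exp (- 2 * of_int n * T) / cosh (2 * of_int n * T) + exp (- 2 * of_int n * (- T)) / cosh (2 * of_int n * T) = 2"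
      using cosh_real_pos[of "2 * of_int n * T"]
      by (simp add: add_divide_distrib[symmetric] divide_eq_eq) (simp add: cosh_def)
    then have "of_real (exp (- 2 * of_int n * T) / cosh (2 * of_int n * T))
        + of_real (exp (- 2 * of_int n * (- T)) / cosh (2 * of_int n * T)) = (2::complex)"
      by (metis of_real_add of_real_numeral)
    then show ?thesis by (simp only: distrib_left[symmetric]) (simp only: mult_ac, simp)
  qed
  ultimately have "((\<lambda>n. (4 * of_real pi) * c n) has_sum I T + I (- T)) UNIV"
    by (simp only:)
  moreover have "((\<lambda>n. (4 * of_real pi) * c n) has_sum (4 * of_real pi) * Y a) UNIV"
    unfolding c_def by (intro has_sum_cmult_right has_sum_fourier Y)
  ultimately have "I T + I (- T) = (4 * of_real pi) * Y a"
    by (rule has_sum_unique)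
  moreover have "inner_H T Y (kernel T a) = 1 / (4 * of_real pi) * (I T + I (- T))"
    unfolding I_def
    by (rule inner_H_extension[OF _ kernel_extension[OF a T] T])
       (simp add: continuous_extension_def entire_periodic_continuous[OF Y])
  ultimately show ?thesis by simp
qed

section \<open>Orthogonal subspaces and kernel differences\<close>

lemma cmod_add_square_le: "(cmod (a + b))\<^sup>2 \<le> 2 * (cmod a)\<^sup>2 + 2 * (cmod b)\<^sup>2"
  using cmod_diff_square_le[of a "- b" 0] by simp

lemma subspace_H2: "cfun.subspace (H2 T)"
proof (rule cfun.subspaceI)
  show "0 \<in> H2 T"
    unfolding H2_def
    by (auto intro!: exI[of _ "\<lambda>_. 0"] simp: zero_fun_def)
next
  fix f g assume f: "f \<in> H2 T" and g: "g \<in> H2 T"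
  obtain c where c: "\<And>z. z \<in> strip T \<Longrightarrow> ((\<lambda>n. c n * exp (\<i> * of_int n * z)) has_sum f z) UNIV"
      "(\<lambda>n. (cmod (c n))\<^sup>2 * cosh (2 * of_int n * T)) summable_on UNIV"
    using f by (auto simp: H2_def)
  obtain d where d: "\<And>z. z \<in> strip T \<Longrightarrow> ((\<lambda>n. d n * exp (\<i> * of_int n * z)) has_sum g z) UNIV"
      "(\<lambda>n. (cmod (d n))\<^sup>2 * cosh (2 * of_int n * T)) summable_on UNIV"
    using g by (auto simp: H2_def)
  have series: "((\<lambda>n. (c n + d n) * exp (\<i> * of_int n * z)) has_sum (f + g) z) UNIV" if "z \<in> strip T" for z
    using has_sum_add[OF c(1)[OF that] d(1)[OF that]] by (simp add: distrib_right)
  have norm: "(\<lambda>n. (cmod (c n + d n))\<^sup>2 * cosh (2 * of_int n * T)) summable_on UNIV"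
  proof (rule summable_on_comparison_test)
    show "(\<lambda>n. 2 * ((cmod (c n))\<^sup>2 * cosh (2 * of_int n * T)) + 2 * ((cmod (d n))\<^sup>2 * cosh (2 * of_int n * T)))
        summable_on UNIV"
      by (intro summable_on_add summable_on_cmult_right c d)
    fix n :: int
    have pos: "0 \<le> cosh (2 * of_int n * T)" by (simp add: less_imp_le cosh_real_pos)
    show "(cmod (c n + d n))\<^sup>2 * cosh (2 * of_int n * T)
       \<le> 2 * ((cmod (c n))\<^sup>2 * cosh (2 * of_int n * T)) + 2 * ((cmod (d n))\<^sup>2 * cosh (2 * of_int n * T))"
      using mult_right_mono[OF cmod_add_square_le[of "c n" "d n"] pos] by (simp add: distrib_right mult.assoc)
    show "0 \<le> (cmod (c n + d n))\<^sup>2 * cosh (2 * of_int n * T)" using pos by simp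
  qed
  show "f + g \<in> H2 T"
    unfolding H2_def
  proof (intro CollectI conjI exI[of _ "\<lambda>n. c n + d n"] ballI allI impI)
    show "f + g holomorphic_on strip T"
      unfolding plus_fun_def using f g by (intro holomorphic_on_add) (simp_all add: H2_def)
  qed (use f g series norm in \<open>simp_all add: H2_def\<close>)
next
  fix a f assume f: "f \<in> H2 T"
  obtain c where c: "\<And>z. z \<in> strip T \<Longrightarrow> ((\<lambda>n. c n * exp (\<i> * of_int n * z)) has_sum f z) UNIV"
      "(\<lambda>n. (cmod (c n))\<^sup>2 * cosh (2 * of_int n * T)) summable_on UNIV"
    using f by (auto simp: H2_def)
  show "fscale a f \<in> H2 T"
    unfolding H2_def
  proof (intro CollectI conjI exI[of _ "\<lambda>n. a * c n"] ballI allI impI)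
    show "fscale a f holomorphic_on strip T"
      unfolding fscale_def using f by (intro holomorphic_on_mult holomorphic_on_const) (simp add: H2_def)
    show "((\<lambda>n. (a * c n) * exp (\<i> * of_int n * z)) has_sum fscale a f z) UNIV" if "z \<in> strip T" for z
      using has_sum_cmult_right[OF c(1)[OF that], of a] by (simp add: fscale_def mult.assoc)
    show "(\<lambda>n. (cmod (a * c n))\<^sup>2 * cosh (2 * of_int n * T)) summable_on UNIV"
      using summable_on_cmult_right[OF c(2), of "(cmod a)\<^sup>2"]
      by (simp add: norm_mult power_mult_distrib mult.assoc)
  qed (use f in \<open>simp_all add: H2_def fscale_def\<close>)
qed

lemma continuous_extension_add:
  "continuous_extension T f F \<Longrightarrow> continuous_extension T g G \<Longrightarrow>
     continuous_extension T (f + g) (\<lambda>z. F z + G z)"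
  by (auto simp: continuous_extension_def intro: continuous_intros)

lemma continuous_extension_fscale:
  "continuous_extension T f F \<Longrightarrow> continuous_extension T (fscale a f) (\<lambda>z. a * F z)"
  by (auto simp: continuous_extension_def fscale_def intro: continuous_intros)

lemma inner_H_integrable:
  assumes "continuous_extension T f F" "continuous_extension T g G" "T > 0" "h = T \<or> h = - T"
  shows "(\<lambda>x. F (Complex x h) * cnj (G (Complex x h))) integrable_on {0..2 * pi}"
  using assms
  by (intro integrable_continuous_real continuous_on_mult continuous_on_cnj
        continuous_on_horizontal[of T]) (auto simp: continuous_extension_def)

lemma inner_H_add:
  assumes f: "continuous_extension T f F" and g: "continuous_extension T g G"
    and k: "continuous_extension T k K" and T: "T > 0"
  shows "inner_H T f (g + k) = inner_H T f g + inner_H T f k"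
proof -
  have "integral {0..2 * pi} (\<lambda>x. F (Complex x h) * cnj (G (Complex x h) + K (Complex x h)))
     = integral {0..2 * pi} (\<lambda>x. F (Complex x h) * cnj (G (Complex x h)))
       + integral {0..2 * pi} (\<lambda>x. F (Complex x h) * cnj (K (Complex x h)))"
    if h: "h = T \<or> h = - T" for h
    using Henstock_Kurzweil_Integration.integral_add[OF inner_H_integrable[OF f g T h] inner_H_integrable[OF f k T h]]
    by (simp add: distrib_left)
  then show ?thesis
    unfolding inner_H_extension[OF f g T] inner_H_extension[OF f k T]
      inner_H_extension[OF f continuous_extension_add[OF g k] T]
    by (simp add: add_divide_distrib)
qed

lemma inner_H_fscale:
  assumes f: "continuous_extension T f F" and g: "continuous_extension T g G" and T: "T > 0"
  shows "inner_H T f (fscale a g) = cnj a * inner_H T f g"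
proof -
  have "integral {0..2 * pi} (\<lambda>x. F (Complex x h) * cnj (a * G (Complex x h)))
     = cnj a * integral {0..2 * pi} (\<lambda>x. F (Complex x h) * cnj (G (Complex x h)))" for h
    unfolding integral_mult_right[symmetric] by (simp add: mult.left_commute)
  then show ?thesis
    unfolding inner_H_extension[OF f g T]
      inner_H_extension[OF f continuous_extension_fscale[OF g] T]
    by (simp add: distrib_left add_divide_distrib)
qed

text \<open>Requiring a continuous extension makes this set a subspace by the explicit integral formula for
  the inner product.\<close>

definition orthogonal_to :: "real \<Rightarrow> (complex \<Rightarrow> complex) \<Rightarrow> (complex \<Rightarrow> complex) set" where
  "orthogonal_to T f = {g. (\<exists>G. continuous_extension T g G) \<and> inner_H T f g = 0}"

lemma subspace_orthogonal_to:
  assumes f: "continuous_extension T f F" and T: "T > 0"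
  shows "cfun.subspace (orthogonal_to T f)"
proof (rule cfun.subspaceI)
  have ext: "continuous_extension T 0 (\<lambda>_. 0)" by (simp add: continuous_extension_def)
  have "inner_H T f 0 = 0"
    unfolding inner_H_extension[OF f ext T] by simp
  with ext show "0 \<in> orthogonal_to T f" by (auto simp: orthogonal_to_def)
next
  fix g k assume "g \<in> orthogonal_to T f" "k \<in> orthogonal_to T f"
  then obtain G K where "continuous_extension T g G" "continuous_extension T k K"
      "inner_H T f g = 0" "inner_H T f k = 0"
    by (auto simp: orthogonal_to_def)
  then show "g + k \<in> orthogonal_to T f"
    using continuous_extension_add inner_H_add[OF f _ _ T] unfolding orthogonal_to_def by fastforce
next
  fix a g assume "g \<in> orthogonal_to T f"
  then obtain G where "continuous_extension T g G" "inner_H T f g = 0"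
    by (auto simp: orthogonal_to_def)
  then show "fscale a g \<in> orthogonal_to T f"
    using continuous_extension_fscale inner_H_fscale[OF f _ T] unfolding orthogonal_to_def by fastforce
qed

definition kernel_difference :: "real \<Rightarrow> complex \<Rightarrow> complex \<Rightarrow> complex \<Rightarrow> complex" where
  "kernel_difference T a b = kernel T a + fscale (- 1) (kernel T b)"

lemma kernel_difference_in_H2:
  "a \<in> strip T \<Longrightarrow> b \<in> strip T \<Longrightarrow> T > 0 \<Longrightarrow> kernel_difference T a b \<in> H2 T"
  unfolding kernel_difference_def
  by (intro cfun.subspace_add[OF subspace_H2] cfun.subspace_scale[OF subspace_H2] kernel_in_H2)

lemma entire_periodic_extension: "entire_periodic Y \<Longrightarrow> continuous_extension T Y Y"
  by (simp add: continuous_extension_def entire_periodic_continuous)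

lemma kernel_difference_extension:
  assumes "a \<in> strip T" "b \<in> strip T" "T > 0"
  shows "\<exists>G. continuous_extension T (kernel_difference T a b) G"
  unfolding kernel_difference_def
  using continuous_extension_add[OF kernel_extension[OF assms(1,3)]
      continuous_extension_fscale[OF kernel_extension[OF assms(2,3)]]] by blast

lemma inner_H_kernel_difference:
  assumes Y: "entire_periodic Y" and a: "a \<in> strip T" and b: "b \<in> strip T" and T: "T > 0"
  shows "inner_H T Y (kernel_difference T a b) = Y a - Y b"
  unfolding kernel_difference_def
  using inner_H_add[OF entire_periodic_extension[OF Y] kernel_extension[OF a T]
      continuous_extension_fscale[OF kernel_extension[OF b T]] T, of "- 1"]
    inner_H_fscale[OF entire_periodic_extension[OF Y] kernel_extension[OF b T] T, of "- 1"]
    inner_H_kernel[OF Y a T] inner_H_kernel[OF Y b T]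
  by simp

lemma kernel_difference_orthogonal_iff:
  assumes "entire_periodic Y" "a \<in> strip T" "b \<in> strip T" "T > 0"
  shows "kernel_difference T a b \<in> orthogonal_to T Y \<longleftrightarrow> Y a = Y b"
  using kernel_difference_extension[OF assms(2-4)] inner_H_kernel_difference[OF assms]
  by (auto simp: orthogonal_to_def)

text \<open>The separating subspaces make the sequence linearly independent, so its first \<open>card B + 1\<close>
  members cannot all lie in the span of \<open>B\<close>.\<close>

lemma not_finitely_spanned_if_separated:
  fixes g :: "nat \<Rightarrow> complex \<Rightarrow> complex"
  assumes sep: "\<And>J k. finite J \<Longrightarrow> k \<notin> J \<Longrightarrow>
      \<exists>S. cfun.subspace S \<and> g ` J \<subseteq> S \<and> g k \<notin> S"
    and B: "finite B" "range g \<subseteq> cfun.span B"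
  shows False
proof -
  have inj: "inj g"
  proof (rule injI, rule ccontr)
    fix j k assume "g j = g k" "j \<noteq> k"
    then show False using sep[of "{j}" k] by auto
  qed
  define m where "m = Suc (card B)"
  have "\<not> cfun.dependent (g ` {..<m})"
  proof
    assume "cfun.dependent (g ` {..<m})"
    then obtain k where k: "k < m" "g k \<in> cfun.span (g ` {..<m} - {g k})"
      unfolding cfun.dependent_def by blast
    obtain S where S: "cfun.subspace S" "g ` ({..<m} - {k}) \<subseteq> S" "g k \<notin> S"
      using sep[of "{..<m} - {k}" k] by blast
    have "g ` {..<m} - {g k} \<subseteq> g ` ({..<m} - {k})" by blast
    then have "cfun.span (g ` {..<m} - {g k}) \<subseteq> S"
      using S(1,2) by (intro cfun.span_minimal) auto
    with k(2) S(3) show False by blast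
  qed
  moreover have "g ` {..<m} \<subseteq> cfun.span B" using B(2) by blast
  ultimately have "card (g ` {..<m}) \<le> card B"
    using cfun.independent_span_bound[OF B(1)] by blast
  moreover have "card (g ` {..<m}) = m"
    using inj by (simp add: card_image inj_on_subset)
  ultimately show False by (simp add: m_def)
qed

text \<open>The separating subspace is the orthogonal complement of a product of factors
  \<open>exp (\<i> * s) - exp (\<i> * c)\<close>: it vanishes at all the points involved except \<open>a k\<close>, and by the
  reproducing property its inner product with a kernel difference is the difference of its values.\<close>

lemma kernel_differences_not_finitely_spanned:
  fixes a b :: "nat \<Rightarrow> complex"
  assumes T: "T > 0" and strip: "\<And>k. a k \<in> strip T" "\<And>k. b k \<in> strip T"
    and a: "inj (\<lambda>k. exp (\<i> * a k))" and ab: "\<And>j k. exp (\<i> * a j) \<noteq> exp (\<i> * b k)"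
    and B: "finite B" "range (\<lambda>k. kernel_difference T (a k) (b k)) \<subseteq> cfun.span B"
  shows False
proof (rule not_finitely_spanned_if_separated[OF _ B])
  fix J :: "nat set" and k assume J: "finite J" "k \<notin> J"
  define Y where "Y = (\<lambda>s. (\<Prod>j\<in>J. exp (\<i> * s) - exp (\<i> * a j)) * (\<Prod>j\<in>insert k J. exp (\<i> * s) - exp (\<i> * b j)))"
  have Y: "entire_periodic Y"
    unfolding Y_def
    using entire_periodic_exp[of 1]
    by (intro entire_periodic_mult entire_periodic_prod entire_periodic_diff entire_periodic_const) simp_all
  have b0: "Y (b j) = 0" if "j \<in> insert k J" for j
    using that J(1) unfolding Y_def by (intro mult_eq_0_iff[THEN iffD2] disjI2) (auto simp: prod_zero_iff)
  have a0: "Y (a j) = 0" if "j \<in> J" for j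
    using that J(1) unfolding Y_def by (intro mult_eq_0_iff[THEN iffD2] disjI1) (auto simp: prod_zero_iff)
  have "exp (\<i> * a k) \<noteq> exp (\<i> * a j)" if "j \<in> J" for j
    using a J(2) that unfolding inj_def by blast
  then have ak: "Y (a k) \<noteq> 0"
    using J(1) ab unfolding Y_def by (auto simp: prod_zero_iff)
  note iff = kernel_difference_orthogonal_iff[OF Y strip(1) strip(2) T]
  show "\<exists>S. cfun.subspace S \<and> (\<lambda>k. kernel_difference T (a k) (b k)) ` J \<subseteq> S
      \<and> kernel_difference T (a k) (b k) \<notin> S"
  proof (intro exI[of _ "orthogonal_to T Y"] conjI)
    show "cfun.subspace (orthogonal_to T Y)"
      by (rule subspace_orthogonal_to[OF entire_periodic_extension[OF Y] T])
    show "(\<lambda>k. kernel_difference T (a k) (b k)) ` J \<subseteq> orthogonal_to T Y"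
      using a0 b0 by (auto simp: iff)
    show "kernel_difference T (a k) (b k) \<notin> orthogonal_to T Y"
      using ak b0 by (simp add: iff)
  qed
qed

section \<open>The eigenfunctions span a subspace of infinite codimension\<close>

theorem proposition3p4:
  fixes q :: "complex \<Rightarrow> complex"
  assumes entire: "q holomorphic_on UNIV"
    and nonconstant: "\<not> q constant_on UNIV"
    and periodic: "\<And>z. q (z + 2 * of_real pi) = q z"
    and positive: "\<And>x::real. q (of_real x) \<in> \<real> \<and> 0 < Re (q (of_real x))"
  shows "(\<forall>T>0. \<forall>f. (\<exists>\<mu>. periodic_eigenfunction T (p_fun q) \<mu> f) \<longleftrightarrow>
            (\<exists>n c. c \<noteq> 0 \<and> (\<forall>z\<in>strip T. f z = c * y_fun q n z)))
       \<and> (\<exists>T0>0. \<forall>T\<ge>T0. \<exists>N. cfun.subspace N \<and> N \<subseteq> H2 T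
            \<and> \<not> (\<exists>B. finite B \<and> N \<subseteq> cfun.span B)
            \<and> (\<forall>g\<in>N. \<forall>n. inner_H T (y_fun q n) g = 0))"
proof -
  interpret real_periodic_exponent q
    by unfold_locales (simp_all only: entire periodic positive)
  obtain a b :: "nat \<Rightarrow> complex" and R where points: "\<forall>k. w (a k) = w (b k)"
      "\<forall>k. \<bar>Im (a k)\<bar> < R \<and> \<bar>Im (b k)\<bar> < R"
      "inj (\<lambda>k. exp (\<i> * a k))" "\<forall>j k. exp (\<i> * a j) \<noteq> exp (\<i> * b k)"
    by (rule double_points_sequence[OF w_holomorphic w_shift w_not_injective[OF nonconstant]], rule that)
  note ab = points(1)[rule_format] and sep = points(3) points(4)[rule_format]
  have Im: "\<bar>Im (a k)\<bar> < R" "\<bar>Im (b k)\<bar> < R" for k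
    using points(2) by simp_all
  have R: "R > 0" using Im(1)[of 0] by linarith
  have main: "\<exists>N. cfun.subspace N \<and> N \<subseteq> H2 T \<and> \<not> (\<exists>B. finite B \<and> N \<subseteq> cfun.span B)
          \<and> (\<forall>g\<in>N. \<forall>n. inner_H T (y_fun q n) g = 0)" if "T \<ge> R" for T
  proof -
    have T: "T > 0" using R that by linarith
    have strip: "a k \<in> strip T" "b k \<in> strip T" for k
      using Im[of k] that by (auto simp: strip_def)
    define g where "g = (\<lambda>k. kernel_difference T (a k) (b k))"
    have orth: "cfun.span (range g) \<subseteq> orthogonal_to T (y_fun q n)" for n
    proof (rule cfun.span_minimal)
      show "range g \<subseteq> orthogonal_to T (y_fun q n)"
      proof
        fix h assume "h \<in> range g"
        then obtain k where h: "h = kernel_difference T (a k) (b k)" by (auto simp: g_def)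
        have "y_fun q n (a k) = y_fun q n (b k)" by (simp only: y_fun_def ab)
        then show "h \<in> orthogonal_to T (y_fun q n)"
          unfolding h kernel_difference_orthogonal_iff[OF y_entire_periodic strip T] .
      qed
      show "cfun.subspace (orthogonal_to T (y_fun q n))"
        by (rule subspace_orthogonal_to[OF entire_periodic_extension[OF y_entire_periodic] T])
    qed
    show ?thesis
    proof (intro exI[of _ "cfun.span (range g)"] conjI)
      show "cfun.subspace (cfun.span (range g))" by (rule cfun.subspace_span)
      show "cfun.span (range g) \<subseteq> H2 T"
        unfolding g_def
        by (intro cfun.span_minimal subspace_H2 image_subsetI kernel_difference_in_H2[OF strip T])
      show "\<not> (\<exists>B. finite B \<and> cfun.span (range g) \<subseteq> cfun.span B)"
      proof
        assume "\<exists>B. finite B \<and> cfun.span (range g) \<subseteq> cfun.span B"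
        then obtain B where B: "finite B" "cfun.span (range g) \<subseteq> cfun.span B" by blast
        have "range g \<subseteq> cfun.span B"
          using cfun.span_superset B(2) by (rule order_trans)
        then show False
          unfolding g_def by (rule kernel_differences_not_finitely_spanned[OF T strip sep B(1)])
      qed
      show "\<forall>h\<in>cfun.span (range g). \<forall>n. inner_H T (y_fun q n) h = 0"
      proof (intro ballI allI)
        fix h n assume "h \<in> cfun.span (range g)"
        then have "h \<in> orthogonal_to T (y_fun q n)" by (rule subsetD[OF orth])
        then show "inner_H T (y_fun q n) h = 0" by (simp add: orthogonal_to_def)
      qed
    qed
  qed
  show ?thesis
  proof (intro conjI)
    show "\<forall>T>0. \<forall>f. (\<exists>\<mu>. periodic_eigenfunction T p \<mu> f) \<longleftrightarrow>
            (\<exists>n c. c \<noteq> 0 \<and> (\<forall>z\<in>strip T. f z = c * y_fun q n z))"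
      by (intro allI impI periodic_eigenfunction_iff)
    show "\<exists>T0>0. \<forall>T\<ge>T0. \<exists>N. cfun.subspace N \<and> N \<subseteq> H2 T
            \<and> \<not> (\<exists>B. finite B \<and> N \<subseteq> cfun.span B)
            \<and> (\<forall>g\<in>N. \<forall>n. inner_H T (y_fun q n) g = 0)"
      by (intro exI[of _ R] conjI allI impI R main)
  qed
qed

end
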